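(* Let loss $\ell\in\{\ell_{\exp},\ell_{\log}\}$ be given. Let $w_0=0$, $w_{j+1}=w_j-\eta_j\nabla\mathcal R(w_j)$, and let $\bar w_t:=\arg\min\{\mathcal R(w):|w|\le|w_t|\}$. 1. (Separable case.) Suppose $A$ is separable (thus $S^\perp=\mathbb R^d$, and $A=A_c=A_\perp$, and $A\bar u=A_\perp\bar u\le-\gamma$ coordinate-wise). Furthermore, suppose $\eta_j=1$, and $t\ge5$, and $\dfrac{t}{\ln(t)^3}\ge\dfrac{n}{\gamma^4}$. Then $$\max\left\{\left|\frac{w_t}{|w_t|}-\bar u\right|^2,\ \left|\frac{\bar w_t}{|\bar w_t|}-\bar u\right|^2\right\}=O\!\left(\frac{\ln n+\ln(|w_t|)}{|w_t|\gamma^2}\right)=O\!\left(\frac{\ln n+\ln\ln t}{\gamma^2\ln t}\right).$$ 2. (General case.) Suppose $\eta_j=1/\sqrt{j+1}$, and $t\ge5$, and $\dfrac{\sqrt t}{\ln(t)^3}\ge\dfrac{n(1+R)}{\gamma^2}$, where $R:=\sup_{j<t}|\Pi_Sw_j|=O(1)$. Then $$|\Pi_Sw_t|=\Theta(1)\qquad\text{and}\qquad\max\left\{|\Pi_Sw_t-\bar v|^2,\ |\Pi_S\bar w_t-\bar v|^2\right\}=O\!\left(\frac{\ln(t)^2}{\sqrt t}\right),$$ and if $A_c$ is nonempty, then $|\Pi_{S^\perp}w_t|=\Theta(\ln(t))$, and $$\max\left\{\left|\frac{w_t}{|w_t|}-\bar u\right|^2,\ \left|\frac{\bar w_t}{|\bar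 w_t|}-\bar u\right|^2\right\}=O\!\left(\frac{\ln n+\ln|w_t|}{|w_t|\gamma^2}\right)=O\!\left(\frac{\ln n+\ln\ln t}{\gamma^2\ln t}\right).$$
   Context: $|\cdot|$ is the Euclidean norm. $A\in\mathbb R^{n\times d}$ is a data matrix with rows $A_i=-y_ix_i^\top$ satisfying $\max_i|A_i|\le1$. $\ell_{\exp}(z)=e^z$, $\ell_{\log}(z)=\ln(1+e^z)$; for a vector $v$ of any dimension $L(v)=\sum_i\ell(v_i)$; $\mathcal R(w)=L(Aw)/n$. Row $i$ of $A$ is placed in $A_c$ if there is $u\in\mathbb R^d$ with $Au\le0$ coordinate-wise and $(Au)_i<0$, otherwise in $A_S$. $S$ is the span of the rows of $A_S$ ($\{0\}$ if there are none); $\Pi_S,\Pi_{S^\perp}$ are the orthogonal projections onto $S,S^\perp$. $\bar v$ is the unique minimizer over $S$ of $v\mapsto L(A_Sv)$. $A_\perp$ has as rows the orthogonal projections of the rows of $A_c$ onto $S^\perp$. If $A_c$ is nonempty, $\gamma=-\min\{\max_i(A_\perp u)_i:|u|=1\}>0$ and $\bar u$ is the unique minimizer (a unit vector, lying in $S^\perp$); if $A_c$ is empty, $1/\gamma^2$ is read as $0$. $A$ is separable if there is $u$ with $Au<0$ coordinate-wise.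
   Formalization: The lower bound in |Π_S w_t| = Θ(1) is stated only when v̄ ≠ 0, and for all sufficiently large t; when v̄ = 0 (e.g. rows 1 and −1 in R¹, or A_S empty) Π_S w_t tends to 0 and the claimed lower bound fails. *)

theory Defs
  imports "HOL-Analysis.Analysis"
begin

text \<open>
  The constants hidden in the asymptotic notation have to be chosen before the dimension \<open>d\<close> and the
  number of rows \<open>n\<close>, so \<open>d\<close> cannot be a type.  All the spaces \<open>R^d\<close> are therefore realized inside
  one inner product space, the finitely supported real sequences: \<open>Rd d\<close> is the \<open>d\<close>-dimensional
  subspace of the sequences supported on the coordinates \<open>0, \<dots>, d - 1\<close>, with the Euclidean
  inner product and norm.
\<close>

typedef rvec = "{f :: nat \<Rightarrow> real. finite {i. f i \<noteq> 0}}"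
  morphisms coord Abs_rvec
  by (rule exI[of _ "\<lambda>_. 0"]) simp

setup_lifting type_definition_rvec

lemma finite_coord: "finite {i. coord x i \<noteq> 0}"
  using coord[of x] by simp

lemma rvec_eqI: "(\<And>i. coord x i = coord y i) \<Longrightarrow> x = y"
  by (simp add: coord_inject[symmetric] fun_eq_iff)

instantiation rvec :: real_vector
begin

lift_definition zero_rvec :: rvec is "\<lambda>_. 0" by simp

lift_definition plus_rvec :: "rvec \<Rightarrow> rvec \<Rightarrow> rvec" is "\<lambda>f g i. f i + g i"
  subgoal for f g by (rule finite_subset[of _ "{i. f i \<noteq> 0} \<union> {i. g i \<noteq> 0}"]) auto
  done

lift_definition uminus_rvec :: "rvec \<Rightarrow> rvec" is "\<lambda>f i. - f i" by simp

lift_definition minus_rvec :: "rvec \<Rightarrow> rvec \<Rightarrow> rvec" is "\<lambda>f g i. f i - g i"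
  subgoal for f g by (rule finite_subset[of _ "{i. f i \<noteq> 0} \<union> {i. g i \<noteq> 0}"]) auto
  done

lift_definition scaleR_rvec :: "real \<Rightarrow> rvec \<Rightarrow> rvec" is "\<lambda>c f i. c * f i"
  by (rule finite_subset) auto

instance
  by standard (transfer; simp add: fun_eq_iff algebra_simps)+

end

lemma coord_simps [simp]:
  "coord 0 i = 0" "coord (x + y) i = coord x i + coord y i" "coord (- x) i = - coord x i"
  "coord (x - y) i = coord x i - coord y i" "coord (c *\<^sub>R x) i = c * coord x i"
  by (transfer; simp)+

instantiation rvec :: real_inner
begin

definition inner_rvec :: "rvec \<Rightarrow> rvec \<Rightarrow> real" where
  "inner_rvec x y = (\<Sum>i | coord x i \<noteq> 0. coord x i * coord y i)"

definition norm_rvec :: "rvec \<Rightarrow> real" where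
  "norm_rvec x = sqrt (inner x x)"

definition sgn_rvec :: "rvec \<Rightarrow> rvec" where
  "sgn_rvec x = x /\<^sub>R norm x"

definition dist_rvec :: "rvec \<Rightarrow> rvec \<Rightarrow> real" where
  "dist_rvec x y = norm (x - y)"

definition uniformity_rvec :: "(rvec \<times> rvec) filter" where
  "uniformity_rvec = (INF e\<in>{0 <..}. principal {(x, y). dist x y < e})"

definition open_rvec :: "rvec set \<Rightarrow> bool" where
  "open_rvec U \<longleftrightarrow> (\<forall>x\<in>U. eventually (\<lambda>(x', y). x' = x \<longrightarrow> y \<in> U) uniformity)"

lemma inner_rvec_superset:
  assumes "finite I" "{i. coord x i \<noteq> 0} \<subseteq> I"
  shows "inner x y = (\<Sum>i\<in>I. coord x i * coord y i)"
  unfolding inner_rvec_def using assms by (intro sum.mono_neutral_left) auto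

instance
proof
  fix x y z :: rvec and r :: real
  let ?supp = "\<lambda>x. {i. coord x i \<noteq> 0}"
  let ?I = "?supp x \<union> ?supp y"
  have fin: "finite ?I" by (simp add: finite_coord)
  have eq: "inner u v = (\<Sum>i\<in>?I. coord u i * coord v i)" if "?supp u \<subseteq> ?I" for u v
    using inner_rvec_superset[OF fin that] .
  show "inner x y = inner y x"
    by (simp add: eq mult.commute)
  have "?supp (x + y) \<subseteq> ?I" by auto
  then show "inner (x + y) z = inner x z + inner y z"
    by (simp add: eq sum.distrib algebra_simps)
  have "?supp (r *\<^sub>R x) \<subseteq> ?I" by auto
  then show "inner (r *\<^sub>R x) y = r * inner x y"
    by (simp add: eq sum_distrib_left mult.assoc)
  show "0 \<le> inner x x"
    by (simp add: inner_rvec_def sum_nonneg)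
  show "inner x x = 0 \<longleftrightarrow> x = 0"
  proof
    assume "inner x x = 0"
    then have "\<forall>i\<in>?supp x. coord x i * coord x i = 0"
      unfolding inner_rvec_def by (subst (asm) sum_nonneg_eq_0_iff) (auto simp: finite_coord)
    then show "x = 0" by (intro rvec_eqI) auto
  qed (simp add: inner_rvec_def)
qed (fact norm_rvec_def sgn_rvec_def dist_rvec_def uniformity_rvec_def open_rvec_def)+

end

definition Rd :: "nat \<Rightarrow> rvec set" where
  "Rd d = {x. \<forall>i\<ge>d. coord x i = 0}"

definition orth_proj :: "'a::real_inner set \<Rightarrow> 'a \<Rightarrow> 'a" where
  "orth_proj S x = (THE y. y \<in> S \<and> (\<forall>s\<in>S. inner (x - y) s = 0))"

definition grad :: "('a::real_inner \<Rightarrow> real) \<Rightarrow> 'a \<Rightarrow> 'a" where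
  "grad f x = (THE D. GDERIV f x :> D)"

definition loss_exp :: "real \<Rightarrow> real" where
  "loss_exp z = exp z"

definition loss_log :: "real \<Rightarrow> real" where
  "loss_log z = ln (1 + exp z)"

text \<open>A matrix with \<open>n\<close> rows in \<open>R^d\<close> is the list of its rows; \<open>A \<odot> w\<close> is the vector \<open>A w\<close> of length \<open>n\<close>.\<close>

definition matvec :: "rvec list \<Rightarrow> rvec \<Rightarrow> real list" (infixr \<open>\<odot>\<close> 75) where
  "A \<odot> w = map (\<lambda>a. inner a w) A"

definition Loss :: "(real \<Rightarrow> real) \<Rightarrow> real list \<Rightarrow> real" where
  "Loss l v = (\<Sum>z\<leftarrow>v. l z)"

text \<open>The risk only depends on inner products with the rows.  Hence, for rows in \<open>Rd d\<close>, its gradient at a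
  point of \<open>Rd d\<close> lies in \<open>Rd d\<close> and is the gradient of its restriction to \<open>Rd d\<close>.\<close>

definition risk :: "(real \<Rightarrow> real) \<Rightarrow> rvec list \<Rightarrow> rvec \<Rightarrow> real" where
  "risk l A w = Loss l (A \<odot> w) / real (length A)"

primrec gd :: "(real \<Rightarrow> real) \<Rightarrow> rvec list \<Rightarrow> (nat \<Rightarrow> real) \<Rightarrow> nat \<Rightarrow> rvec" where
  "gd l A \<eta> 0 = 0"
| "gd l A \<eta> (Suc j) = gd l A \<eta> j - \<eta> j *\<^sub>R grad (risk l A) (gd l A \<eta> j)"

definition data_matrix :: "nat \<Rightarrow> rvec list \<Rightarrow> bool" where
  "data_matrix d A \<longleftrightarrow> A \<noteq> [] \<and> set A \<subseteq> Rd d \<and> (\<forall>a\<in>set A. norm a \<le> 1)"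

definition separable :: "nat \<Rightarrow> rvec list \<Rightarrow> bool" where
  "separable d A \<longleftrightarrow> (\<exists>u\<in>Rd d. \<forall>z\<in>set (A \<odot> u). z < 0)"

text \<open>Whether row \<open>i\<close> belongs to \<open>A_c\<close> depends on \<open>i\<close> only through the vector \<open>a = A ! i\<close>.\<close>

definition in_Ac :: "nat \<Rightarrow> rvec list \<Rightarrow> rvec \<Rightarrow> bool" where
  "in_Ac d A a \<longleftrightarrow> (\<exists>u\<in>Rd d. (\<forall>z\<in>set (A \<odot> u). z \<le> 0) \<and> inner a u < 0)"

definition Ac :: "nat \<Rightarrow> rvec list \<Rightarrow> rvec list" where
  "Ac d A = filter (in_Ac d A) A"

definition As :: "nat \<Rightarrow> rvec list \<Rightarrow> rvec list" where
  "As d A = filter (\<lambda>a. \<not> in_Ac d A a) A"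

definition S :: "nat \<Rightarrow> rvec list \<Rightarrow> rvec set" where
  "S d A = span (set (As d A))"

definition Sperp :: "nat \<Rightarrow> rvec list \<Rightarrow> rvec set" where
  "Sperp d A = Rd d \<inter> (S d A)\<^sup>\<bottom>"

definition vbar :: "(real \<Rightarrow> real) \<Rightarrow> nat \<Rightarrow> rvec list \<Rightarrow> rvec" where
  "vbar l d A = arg_min (\<lambda>v. Loss l (As d A \<odot> v)) (\<lambda>v. v \<in> S d A)"

definition Aperp :: "nat \<Rightarrow> rvec list \<Rightarrow> rvec list" where
  "Aperp d A = map (orth_proj (Sperp d A)) (Ac d A)"

definition max_entry :: "real list \<Rightarrow> real" where
  "max_entry v = Max (set v)"

text \<open>\<open>ubar\<close> and \<open>\<gamma>\<close> are only meaningful, and only used, when \<open>A_c\<close> is nonempty;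
  the infimum is then attained, at \<open>ubar\<close>.\<close>

definition ubar :: "nat \<Rightarrow> rvec list \<Rightarrow> rvec" where
  "ubar d A = arg_min (\<lambda>u. max_entry (Aperp d A \<odot> u)) (\<lambda>u. u \<in> Rd d \<and> norm u = 1)"

definition margin :: "nat \<Rightarrow> rvec list \<Rightarrow> real" where
  "margin d A = - (INF u\<in>{u \<in> Rd d. norm u = 1}. max_entry (Aperp d A \<odot> u))"

definition inv_margin_sq :: "nat \<Rightarrow> rvec list \<Rightarrow> real" where
  "inv_margin_sq d A = (if Ac d A = [] then 0 else 1 / (margin d A)\<^sup>2)"

text \<open>\<open>b\<close> is a minimizer of the risk over the ball of radius \<open>|w|\<close> in \<open>R^d\<close>.  If \<open>A_c\<close> is empty and the rows
  do not span \<open>R^d\<close> there can be several, so this is a predicate.\<close>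

definition ball_minimizer :: "(real \<Rightarrow> real) \<Rightarrow> nat \<Rightarrow> rvec list \<Rightarrow> rvec \<Rightarrow> rvec \<Rightarrow> bool" where
  "ball_minimizer l d A w b \<longleftrightarrow> is_arg_min (risk l A) (\<lambda>x. x \<in> Rd d \<and> norm x \<le> norm w) b"

definition dir_error :: "nat \<Rightarrow> rvec list \<Rightarrow> rvec \<Rightarrow> real" where
  "dir_error d A w = (norm (w /\<^sub>R norm w - ubar d A))\<^sup>2"

definition dir_rate :: "nat \<Rightarrow> rvec list \<Rightarrow> rvec \<Rightarrow> real" where
  "dir_rate d A w = (ln (real (length A)) + ln (norm w)) / (norm w * (margin d A)\<^sup>2)"

definition dir_rate_t :: "nat \<Rightarrow> rvec list \<Rightarrow> nat \<Rightarrow> real" where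
  "dir_rate_t d A t = (ln (real (length A)) + ln (ln (real t))) / ((margin d A)\<^sup>2 * ln (real t))"

abbreviation w_const :: "(real \<Rightarrow> real) \<Rightarrow> rvec list \<Rightarrow> nat \<Rightarrow> rvec" where
  "w_const l A \<equiv> gd l A (\<lambda>_. 1)"

abbreviation w_decay :: "(real \<Rightarrow> real) \<Rightarrow> rvec list \<Rightarrow> nat \<Rightarrow> rvec" where
  "w_decay l A \<equiv> gd l A (\<lambda>j. 1 / sqrt (real j + 1))"

definition Rsup :: "(real \<Rightarrow> real) \<Rightarrow> nat \<Rightarrow> rvec list \<Rightarrow> nat \<Rightarrow> real" where
  "Rsup l d A t = (SUP j\<in>{..<t}. norm (orth_proj (S d A) (w_decay l A j)))"

definition general_cond :: "(real \<Rightarrow> real) \<Rightarrow> nat \<Rightarrow> rvec list \<Rightarrow> nat \<Rightarrow> bool" where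
  "general_cond l d A t \<longleftrightarrow> t \<ge> 5 \<and>
     sqrt (real t) / ln (real t) ^ 3 \<ge> real (length A) * (1 + Rsup l d A t) * inv_margin_sq d A"

end

theory Submission
  imports Defs "HOL-Real_Asymp.Real_Asymp"
begin

text \<open>
  A step of gradient descent with step size at most \<open>1\<close> decreases the risk and satisfies
  \<open>|w_{j+1} - z|^2 \<le> |w_j - z|^2 + 2 \<eta>_j (R z - R w_{j+1})\<close>. Comparing with \<open>z = vbar + r ubar\<close> bounds the
  projections of all iterates to \<open>S\<close> by \<open>O((1 + ln n) / \<gamma>)\<close>; with strong convexity of the loss on \<open>S\<close> it
  gives the rate of convergence to \<open>vbar\<close>. Comparing with \<open>z = w_t\<close> gives \<open>|w_j| \<le> 2 |w_t|\<close> for \<open>j \<le> t\<close>, so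
  as long as \<open>|w_t|\<close> is small each step advances along \<open>ubar\<close> by a definite amount: \<open>|w_t|\<close> is at least
  of order \<open>ln t\<close>.

  For the direction write \<open>q_j\<close> for the component of \<open>w_j\<close> orthogonal to \<open>S\<close>, and \<open>s_j\<close> for its
  inner product with \<open>ubar\<close>. If \<open>m_j\<close> is the total derivative of the loss on \<open>A_c\<close>, divided by \<open>n\<close>, then
  \<open>s_j\<close> grows by at least \<open>\<gamma> \<eta>_j m_j\<close>. By duality some row of \<open>A_c\<close> has margin at most \<open>\<gamma> s_j\<close> up to
  the projection of \<open>w_j\<close> to \<open>S\<close>, and an entropy estimate shows that \<open>|q_j|^2 / 2\<close> grows by at most
  \<open>\<eta>_j m_j (\<gamma> s_j + O(ln n + |\<Pi>_S w_j|))\<close>. Hence \<open>|q_t|^2 \<le> s_t^2 + O(s_t (1 + ln n) / \<gamma>^2)\<close>, which is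
  the claimed directional bound.
\<close>

section \<open>Convex losses with exponential tails\<close>

text \<open>Two demands shape the estimates. The constants have different scopes: in the separable
  direction bound the constant is absolute, in the general one it may depend on the rows of
  \<open>A_S\<close> but not on n, d or \<gamma>, and in the projection bounds it may depend on all
  of the data. Therefore radii are expressed through \<open>As d A\<close> alone, and n and \<gamma>
  are tracked explicitly. Moreover, the target rate has numerator ln n + ln |w_t|, which for n = 1
  degenerates as |w_t| approaches 1, whereas the direct estimate has numerator 1 + ln n. Absorbing
  the 1 requires |w_t| to exceed 1 by a definite amount as soon as the condition on t holds. For
  small t there is little room for this, whence the tight numerical constants 8/5, 21/20 and
  287/100. Both losses lie between softplus and exp, and their derivatives between the sigmoid and
  the loss itself; only these bounds, convexity and continuity of the second derivative
  enter.\<close>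

locale decaying_loss =
  fixes l l' l'' :: "real \<Rightarrow> real"
  assumes deriv1: "(l has_real_derivative l' z) (at z)"
    and deriv2: "(l' has_real_derivative l'' z) (at z)"
    and continuous2: "continuous_on UNIV l''"
    and second_pos: "0 < l'' z"
    and second_le: "l'' z \<le> l z"
    and first_le: "l' z \<le> l z"
    and le_exp: "l z \<le> exp z"
    and sigmoid_le: "1 / (1 + exp (- z)) \<le> l' z"
    and softplus_le: "ln (1 + exp z) \<le> l z"

lemma decaying_loss_exp: "decaying_loss loss_exp exp exp"
proof
  fix z :: real
  have e: "loss_exp = exp" by (auto simp: loss_exp_def)
  show "(loss_exp has_real_derivative exp z) (at z)" "(exp has_real_derivative exp z) (at z)"
    unfolding e by (rule DERIV_exp)+
  show "1 / (1 + exp (- z)) \<le> exp z"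
    by (simp add: divide_simps distrib_left flip: exp_add) (smt (verit) exp_gt_zero)
  show "ln (1 + exp z) \<le> loss_exp z"
    by (simp add: e ln_add_one_self_le_self)
  show "continuous_on UNIV (exp :: real \<Rightarrow> real)" by (intro continuous_intros)
qed (auto simp: loss_exp_def)

lemma decaying_loss_log:
  "decaying_loss loss_log (\<lambda>z. 1 / (1 + exp (- z))) (\<lambda>z. exp (- z) / (1 + exp (- z))\<^sup>2)"
proof
  fix z :: real
  have pos: "1 + exp z > 0" "1 + exp (- z) > 0" for z :: real
    by (smt (verit) exp_gt_zero)+
  have s: "1 / (1 + exp (- z)) = exp z / (1 + exp z)"
    using pos[of z] by (simp add: exp_minus divide_simps)
  show "(loss_log has_real_derivative 1 / (1 + exp (- z))) (at z)"
    unfolding s loss_log_def[abs_def]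
    by (rule derivative_eq_intros refl | simp add: pos)+
  show "((\<lambda>z. 1 / (1 + exp (- z))) has_real_derivative exp (- z) / (1 + exp (- z))\<^sup>2) (at z)"
    using pos[of z] by (auto intro!: derivative_eq_intros simp: power2_eq_square)
  show "continuous_on UNIV (\<lambda>z::real. exp (- z) / (1 + exp (- z))\<^sup>2)"
  proof (intro continuous_intros ballI)
    fix z :: real
    show "(1 + exp (- z))\<^sup>2 \<noteq> 0" using pos(2)[of z] by simp
  qed
  show "0 < exp (- z) / (1 + exp (- z))\<^sup>2"
    using pos[of z] by simp
  have "1 - inverse (1 + exp z) \<le> ln (1 + exp z)"
    using ln_le_minus_one[of "inverse (1 + exp z)"] pos[of z] by (simp add: ln_inverse)
  moreover have "1 - inverse (1 + exp z) = 1 / (1 + exp (- z))"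
    unfolding s using pos[of z] by (simp add: field_simps)
  ultimately show le: "1 / (1 + exp (- z)) \<le> loss_log z"
    by (simp add: loss_log_def)
  have "exp (- z) / (1 + exp (- z))\<^sup>2 \<le> 1 / (1 + exp (- z))"
    using pos[of z] by (simp add: power2_eq_square divide_simps)
  with le show "exp (- z) / (1 + exp (- z))\<^sup>2 \<le> loss_log z" by simp
  show "loss_log z \<le> exp z" by (simp add: loss_log_def ln_add_one_self_le_self)
qed (auto simp: loss_log_def)

lemma taylor_second_order:
  fixes f f' f'' :: "real \<Rightarrow> real"
  assumes "\<And>z. (f has_real_derivative f' z) (at z)" "\<And>z. (f' has_real_derivative f'' z) (at z)"
  obtains \<xi> where "min x y \<le> \<xi>" "\<xi> \<le> max x y"
    "f y = f x + f' x * (y - x) + f'' \<xi> / 2 * (y - x)\<^sup>2"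
proof (cases "x = y")
  case False
  define D where "D m = (if m = 0 then f else if m = 1 then f' else f'')" for m :: nat
  have "\<forall>m t. m < 2 \<and> min x y \<le> t \<and> t \<le> max x y \<longrightarrow> DERIV (D m) t :> D (Suc m) t"
    using assms by (auto simp: D_def less_2_cases_iff)
  from Taylor[of 2 D f "min x y" "max x y" x y] this False obtain t
    where "if y < x then y < t \<and> t < x else x < t \<and> t < y"
      "f y = (\<Sum>m<2. D m x / fact m * (y - x) ^ m) + D 2 t / fact 2 * (y - x)\<^sup>2"
    by (auto simp: D_def)
  then show ?thesis
    by (intro that[of t]) (auto simp: D_def numeral_2_eq_2 split: if_splits)
qed (auto intro: that)

context decaying_loss
begin

lemma first_pos: "0 < l' z"
  using sigmoid_le[of z] by (smt (verit) divide_pos_pos exp_gt_zero)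

lemma loss_pos: "0 < l z"
  using first_pos first_le order_less_le_trans by blast

lemma first_le_exp: "l' z \<le> exp z"
  using first_le le_exp order_trans by blast

lemma first_mono: "x \<le> y \<Longrightarrow> l' x \<le> l' y"
  by (rule DERIV_nonneg_imp_nondecreasing) (auto intro!: exI deriv2 less_imp_le[OF second_pos])

lemma pos_part_le: "max 0 z \<le> l z"
proof -
  have "ln (exp z) \<le> ln (1 + exp z)" by (subst ln_le_cancel_iff) (auto simp: add_pos_pos)
  with softplus_le[of z] loss_pos[of z] show ?thesis by simp
qed

text \<open>Inverts the softplus lower bound: \<open>1 + exp z \<le> exp x \<le> 1 + 2 * x\<close>
  for x at most 1. For the ball minimizers it turns a small loss of a row into a large
  margin.\<close>

lemma exp_le_twice:
  assumes "l z \<le> x" "x \<le> 1"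
  shows "exp z \<le> 2 * x"
proof -
  have "0 < x" using loss_pos[of z] assms by linarith
  have "1 + exp z \<le> exp x"
    using softplus_le[of z] assms by (smt (verit) exp_gt_zero exp_ln exp_le_cancel_iff)
  also have "exp x \<le> 1 + x + x\<^sup>2"
    using exp_bound[of x] \<open>0 < x\<close> assms by simp
  also have "\<dots> \<le> 1 + 2 * x"
    using mult_left_mono[of x 1 x] \<open>0 < x\<close> assms by (simp add: power2_eq_square)
  finally show ?thesis by simp
qed

lemma above_tangent: "l z + l' z * (y - z) \<le> l y"
proof -
  obtain \<xi> where "l y = l z + l' z * (y - z) + l'' \<xi> / 2 * (y - z)\<^sup>2"
    using taylor_second_order[OF deriv1 deriv2] by blast
  with second_pos[of \<xi>] show ?thesis by simp
qed

lemma loss_convex: "convex_on UNIV l"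
  by (rule f''_ge0_imp_convex[OF _ deriv1 deriv2]) (auto simp: less_imp_le second_pos)

text \<open>Bounding \<open>l''\<close> on the segment by the chord of \<open>l\<close> gives a quadratic error relative to the loss.\<close>

lemma relative_smoothness: "l (z + x) \<le> l z + l' z * x + x\<^sup>2 * (l z / 3 + l (z + x) / 6)"
proof -
  \<comment> \<open>\<open>f r\<close> compares \<open>l (z + r * x)\<close> with the function of
    equal value and slope at 0 whose second derivative in r is x^2 times the chord of the loss. At r
    = 1 the weights 1/2 and 1/6 combine to 1/3 and 1/6.\<close>
  define f where "f r = l z + l' z * (r * x) + x\<^sup>2 * (r\<^sup>2 / 2 * l z + r^3 / 6 * (l (z + x) - l z)) - l (z + r * x)" for r
  define f' where "f' r = l' z * x + x\<^sup>2 * (r * l z + r\<^sup>2 / 2 * (l (z + x) - l z)) - l' (z + r * x) * x" for r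
  define f'' where "f'' r = x\<^sup>2 * (l z + r * (l (z + x) - l z)) - l'' (z + r * x) * x\<^sup>2" for r
  have d1: "(f has_real_derivative f' r) (at r)" for r
    unfolding f_def f'_def
    by (rule derivative_eq_intros DERIV_chain2[OF deriv1] refl | simp)+
  have d2: "(f' has_real_derivative f'' r) (at r)" for r
    unfolding f'_def f''_def
    by (rule derivative_eq_intros DERIV_chain2[OF deriv2] refl | simp)+
      (simp add: power2_eq_square)
  obtain r where r: "0 \<le> r" "r \<le> 1" "f 1 = f 0 + f' 0 * (1 - 0) + f'' r / 2 * (1 - 0)\<^sup>2"
    using taylor_second_order[OF d1 d2, of 0 1] by auto
  have "l'' (z + r * x) \<le> l (z + r * x)" by (rule second_le)
  also have "z + r * x = (1 - r) *\<^sub>R z + r *\<^sub>R (z + x)" by (simp add: algebra_simps)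
  also have "l \<dots> \<le> (1 - r) * l z + r * l (z + x)"
    using convex_onD[OF loss_convex, of r z "z + x"] r by simp
  finally have "x\<^sup>2 * l'' (z + r * x) \<le> x\<^sup>2 * (l z + r * (l (z + x) - l z))"
    by (intro mult_left_mono) (auto simp: algebra_simps)
  then have "0 \<le> f'' r" by (simp add: f''_def mult.commute)
  moreover have "f 0 = 0" "f' 0 = 0" by (simp_all add: f_def f'_def)
  ultimately have "0 \<le> f 1" using r(3) by simp
  then show ?thesis by (simp add: f_def algebra_simps)
qed

text \<open>Strong convexity in midpoint form, on a bounded interval because \<open>l''\<close>
  tends to 0 at minus infinity. The midpoint form makes derivatives at a minimizer unnecessary
  later.\<close>

lemma midpoint_gap:
  obtains c where "0 < c"
    "\<And>x y. \<bar>x\<bar> \<le> M \<Longrightarrow> \<bar>y\<bar> \<le> M \<Longrightarrow> l ((x + y) / 2) + c * (x - y)\<^sup>2 \<le> (l x + l y) / 2"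
proof (cases "M \<ge> 0")
  case True
  then have "\<exists>x0\<in>{-M..M}. \<forall>x\<in>{-M..M}. l'' x0 \<le> l'' x"
    by (intro continuous_attains_inf continuous_on_subset[OF continuous2]) auto
  then obtain x0 where x0: "\<And>x. x \<in> {-M..M} \<Longrightarrow> l'' x0 \<le> l'' x" by blast
  show ?thesis
  proof
    show "0 < l'' x0 / 8" using second_pos by simp
    fix x y assume xy: "\<bar>x\<bar> \<le> M" "\<bar>y\<bar> \<le> M"
    \<comment> \<open>Expanding around the midpoint makes the linear terms cancel in the average;
      the quadratic ones contain ((x - y) / 2)^2 / 2, hence the factor 1/8.\<close>
    define m where "m = (x + y) / 2"
    have *: "l m + l' m * (z - m) + l'' x0 / 2 * (z - m)\<^sup>2 \<le> l z" if "\<bar>z\<bar> \<le> M" for z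
    proof -
      obtain \<xi> where \<xi>: "min m z \<le> \<xi>" "\<xi> \<le> max m z"
        "l z = l m + l' m * (z - m) + l'' \<xi> / 2 * (z - m)\<^sup>2"
        using taylor_second_order[OF deriv1 deriv2] by blast
      have "\<xi> \<in> {-M..M}" using \<xi>(1,2) xy that by (auto simp: m_def min_def max_def split: if_splits)
      then have "l'' x0 * (z - m)\<^sup>2 \<le> l'' \<xi> * (z - m)\<^sup>2" by (intro mult_right_mono x0) auto
      with \<xi>(3) show ?thesis by simp
    qed
    have "x - m = (x - y) / 2" "y - m = - ((x - y) / 2)" by (auto simp: m_def field_simps)
    with *[OF xy(1)] *[OF xy(2)]
    have "l m + l' m * ((x - y) / 2) + l'' x0 / 2 * ((x - y) / 2)\<^sup>2 \<le> l x"
      "l m + l' m * - ((x - y) / 2) + l'' x0 / 2 * ((x - y) / 2)\<^sup>2 \<le> l y" by auto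
    then have "l m + l'' x0 / 8 * (x - y)\<^sup>2 \<le> (l x + l y) / 2"
      by (simp add: power_divide)
    then show "l ((x + y) / 2) + l'' x0 / 8 * (x - y)\<^sup>2 \<le> (l x + l y) / 2" by (simp add: m_def)
  qed
next
  case False
  then show ?thesis by (intro that[of 1]) auto
qed

text \<open>Entries that exceed \<open>N\<close> in magnitude by more than \<open>2 ln n\<close> carry a negligible
  part of the total derivative.\<close>

lemma weighted_entries_le:
  assumes "length zs \<le> n" "0 \<le> N" "z0 \<in> set zs" "- N \<le> z0"
  shows "(\<Sum>z\<leftarrow>zs. l' z * (- z)) \<le> (N + 2 * ln n + 2) * (\<Sum>z\<leftarrow>zs. l' z)"
proof -
  have n: "0 < n" using assms by (cases zs) auto
  \<comment> \<open>Below the threshold the factor \<open>- z\<close> is simply bounded. Above it,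
    one half of the exponential decay beats the linear factor and the other half supplies 1/n, so
    that at most n such entries together leave \<open>exp (- N)\<close>.\<close>
  have term_le: "l' z * (- z) \<le> (N + 2 * ln n) * l' z + exp (- N) / n" for z
  proof (cases "- z \<le> N + 2 * ln n")
    case True
    then have "l' z * (- z) \<le> l' z * (N + 2 * ln n)"
      using first_pos[of z] by (intro mult_left_mono) auto
    moreover have "0 \<le> exp (- N) / n" by simp
    ultimately show ?thesis by (simp only: mult.commute)
  next
    case False
    define u where "u = - z - N"
    have u: "2 * ln n < u" using False by (simp add: u_def)
    have "0 \<le> ln n" using n by simp
    have "u \<le> exp (u / 2)"
    proof -
      have "0 < u" using u \<open>0 \<le> ln n\<close> by linarith
      then have "1 + u / 2 + (u / 2)\<^sup>2 / 2 \<le> exp (u / 2)"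
        by (intro exp_lower_Taylor_quadratic) auto
      moreover have "0 \<le> (u / 2 - 1)\<^sup>2" by simp
      ultimately show ?thesis by (simp add: power2_eq_square field_simps)
    qed
    moreover have "n \<le> exp (u / 2)" using u n by (smt (verit) field_sum_of_halves ln_ge_iff of_nat_0_less_iff)
    ultimately have "u * n \<le> exp (u / 2) * exp (u / 2)"
      using u \<open>0 \<le> ln n\<close> by (intro mult_mono) auto
    also have "\<dots> = exp u" by (simp flip: exp_add)
    finally have "u * exp (- u) \<le> 1 / n" using n by (simp add: exp_minus field_simps)
    then have "exp (- N) * (u * exp (- u)) \<le> exp (- N) / n"
      using mult_left_mono[of _ "1 / n" "exp (- N)"] by simp
    moreover have "l' z * u \<le> exp z * u"
      using u \<open>0 \<le> ln n\<close> by (intro mult_right_mono first_le_exp) auto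
    moreover have "exp z = exp (- N) * exp (- u)" by (simp add: u_def flip: exp_add)
    ultimately have "l' z * u \<le> exp (- N) / n" by (simp add: mult_ac)
    moreover have "l' z * (- z) = N * l' z + l' z * u" by (simp add: u_def algebra_simps)
    moreover have "0 \<le> 2 * ln n * l' z" using \<open>0 \<le> ln n\<close> first_pos[of z] by simp
    ultimately show ?thesis by (simp add: algebra_simps)
  qed
  have "(\<Sum>z\<leftarrow>zs. l' z * (- z)) \<le> (\<Sum>z\<leftarrow>zs. (N + 2 * ln n) * l' z + exp (- N) / n)"
    by (intro sum_list_mono term_le)
  also have "\<dots> = (N + 2 * ln n) * (\<Sum>z\<leftarrow>zs. l' z) + length zs * (exp (- N) / n)"
    by (simp add: sum_list_addf sum_list_const_mult sum_list_triv)
  also have "length zs * (exp (- N) / n) \<le> n * (exp (- N) / n)"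
    using assms by (intro mult_right_mono) auto
  also have "\<dots> = exp (- N)" using n by simp
  \<comment> \<open>The entry \<open>z0\<close> pays for the leftover; this is the origin of the
    summand 2.\<close>
  also have "exp (- N) \<le> 2 * l' z0"
  proof -
    have "1 / (1 + exp N) \<le> l' (- N)" using sigmoid_le[of "- N"] by simp
    also have "\<dots> \<le> l' z0" using assms by (intro first_mono)
    finally have "1 / (1 + exp N) \<le> l' z0" .
    moreover have "exp (- N) \<le> 2 * (1 / (1 + exp N))"
    proof -
      have "1 \<le> exp N" using assms by simp
      moreover have "0 < 1 + exp N" by (simp add: add_pos_pos)
      ultimately show ?thesis by (simp add: exp_minus divide_simps)
    qed
    ultimately show ?thesis by linarith
  qed
  also have "l' z0 \<le> (\<Sum>z\<leftarrow>zs. l' z)"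
    using assms first_pos by (intro member_le_sum_list) (auto intro: less_imp_le)
  finally show ?thesis by (simp add: algebra_simps)
qed

end

section \<open>Finite-dimensional subspaces\<close>


lemma span_insert_orthogonal:
  fixes q :: "'a::real_inner"
  assumes "p \<in> span B"
  shows "x \<in> span (insert (p + q) B) \<longleftrightarrow> (\<exists>c. x - c *\<^sub>R q \<in> span B)"
proof -
  have "x - c *\<^sub>R (p + q) \<in> span B \<longleftrightarrow> x - c *\<^sub>R q \<in> span B" for c
  proof -
    have "x - c *\<^sub>R q = (x - c *\<^sub>R (p + q)) + c *\<^sub>R p" by (simp add: algebra_simps)
    then show ?thesis by (metis span_add_eq2 span_scale assms)
  qed
  then show ?thesis by (auto simp: span_insert)
qed

text \<open>Gram-Schmidt induction replaces Heine-Borel, which fails in the space of all finitely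
  supported sequences. Both claims are proved together because compactness for the enlarged set
  needs the projection of the new vector.\<close>

lemma finite_span_projection_compact:
  fixes B :: "'a::real_inner set"
  assumes "finite B"
  shows "(\<forall>x. \<exists>y\<in>span B. \<forall>s\<in>span B. inner (x - y) s = 0) \<and>
    (\<forall>r. compact {x \<in> span B. norm x \<le> r})"
  using assms
proof (induction B rule: finite_induct)
  case empty
  have "finite {x \<in> {0 :: 'a}. norm x \<le> r}" for r by simp
  then show ?case by (auto intro: finite_imp_compact)
next
  case (insert a B)
  then obtain p where p: "p \<in> span B" "\<And>s. s \<in> span B \<Longrightarrow> inner (a - p) s = 0" by blast
  define q where "q = a - p"
  have a: "a = p + q" by (simp add: q_def)
  have q: "inner q s = 0" "inner s q = 0" if "s \<in> span B" for s
    using p(2)[OF that] by (simp_all add: q_def inner_commute)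
  note span_iff = span_insert_orthogonal[OF p(1), of _ q, folded a]
  show ?case
  proof (cases "q = 0")
    case True
    then show ?thesis using insert.IH p(1) a by (simp add: span_redundant)
  next
    case False
    show ?thesis
    proof (intro conjI allI)
      fix x
      obtain y where y: "y \<in> span B" "\<And>s. s \<in> span B \<Longrightarrow> inner (x - y) s = 0"
        using insert.IH by blast
      define c where "c = inner x q / inner q q"
      have c: "c * inner q q = inner x q" using False by (simp add: c_def)
      have "inner (x - (y + c *\<^sub>R q)) s = 0" if s: "s \<in> span (insert a B)" for s
      proof -
        obtain k where "s - k *\<^sub>R q \<in> span B" using s span_iff by blast
        moreover define s0 where "s0 = s - k *\<^sub>R q"
        ultimately have "s0 \<in> span B" "s = s0 + k *\<^sub>R q" by auto
        then show ?thesis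
          using y(2)[of s0] q[of s0] q[OF y(1)] c by (simp add: inner_simps)
      qed
      moreover have "y + c *\<^sub>R q \<in> span (insert a B)"
        unfolding span_iff using y(1) by (intro exI[of _ c]) simp
      ultimately show "\<exists>y\<in>span (insert a B). \<forall>s\<in>span (insert a B). inner (x - y) s = 0" by blast
    next
      fix r
      \<comment> \<open>By Pythagoras both components of a vector in the ball have norm at most r,
        so the ball lies in this continuous image of a compact product. The image may be larger and
        is cut back by \<open>cball 0 r\<close>.\<close>
      define T where "T = (\<lambda>(y, c). y + c *\<^sub>R q) ` ({y \<in> span B. norm y \<le> r} \<times> {- r / norm q..r / norm q})"
      have "compact T"
        unfolding T_def using insert.IH
        by (intro compact_continuous_image compact_Times)
          (auto simp: case_prod_beta intro!: continuous_intros)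
      have "x \<in> T" if x: "x \<in> span (insert a B)" "norm x \<le> r" for x
      proof -
        obtain c where c: "x - c *\<^sub>R q \<in> span B" using x span_iff by blast
        define y where "y = x - c *\<^sub>R q"
        have y: "y \<in> span B" "x = y + c *\<^sub>R q" using c by (auto simp: y_def)
        have "(norm x)\<^sup>2 = (norm y)\<^sup>2 + (norm (c *\<^sub>R q))\<^sup>2"
          unfolding y(2) using q[OF y(1)] by (intro norm_add_Pythagorean) (simp add: orthogonal_def)
        moreover have "(norm x)\<^sup>2 \<le> r\<^sup>2" using x(2) by (intro power_mono) auto
        ultimately have *: "(norm y)\<^sup>2 \<le> r\<^sup>2" "(norm (c *\<^sub>R q))\<^sup>2 \<le> r\<^sup>2"
          using zero_le_power2[of "norm y"] zero_le_power2[of "norm (c *\<^sub>R q)"] by linarith+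
        have "0 \<le> r" using x(2) norm_ge_zero[of x] by linarith
        with * have "norm y \<le> r" "\<bar>c\<bar> * norm q \<le> r"
          by (auto dest: power2_le_imp_le)
        moreover from this have "c \<in> {- r / norm q..r / norm q}"
          using False by (simp add: field_simps abs_le_iff flip: abs_le_iff) (smt (verit) mult_minus_left mult_right_mono norm_ge_zero)
        ultimately show ?thesis unfolding T_def y(2) using y(1) by force
      qed
      moreover have "x \<in> span (insert a B)" if "x \<in> T" for x
      proof -
        from that obtain y c where "y \<in> span B" "x = y + c *\<^sub>R q" by (auto simp: T_def)
        then show ?thesis unfolding span_iff by (intro exI[of _ c]) simp
      qed
      ultimately have "{x \<in> span (insert a B). norm x \<le> r} = T \<inter> cball 0 r" by auto
      with \<open>compact T\<close> show "compact {x \<in> span (insert a B). norm x \<le> r}"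
        by (simp add: compact_Int_closed)
    qed
  qed
qed

lemmas compact_span_ball = finite_span_projection_compact[THEN conjunct2, rule_format]

lemma orth_proj_eqI:
  assumes "subspace T" "y \<in> T" "\<And>s. s \<in> T \<Longrightarrow> inner (x - y) s = 0"
  shows "orth_proj T x = y"
  unfolding orth_proj_def
proof (rule the_equality)
  fix z assume z: "z \<in> T \<and> (\<forall>s\<in>T. inner (x - z) s = 0)"
  then have "z - y \<in> T" using assms subspace_diff by blast
  with z assms(3) have "inner (x - y) (z - y) - inner (x - z) (z - y) = 0" by simp
  then have "inner (z - y) (z - y) = 0" by (simp flip: inner_diff_left)
  then show "z = y" by simp
qed (use assms in blast)

lemma
  fixes B :: "'a::real_inner set"
  assumes "finite B"
  shows orth_proj_span_mem: "orth_proj (span B) x \<in> span B"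
    and orth_proj_span_inner: "s \<in> span B \<Longrightarrow> inner (x - orth_proj (span B) x) s = 0"
proof -
  obtain y where y: "y \<in> span B" "\<And>s. s \<in> span B \<Longrightarrow> inner (x - y) s = 0"
    using finite_span_projection_compact[OF assms] by blast
  then have "orth_proj (span B) x = y" by (intro orth_proj_eqI) auto
  with y show "orth_proj (span B) x \<in> span B"
    "s \<in> span B \<Longrightarrow> inner (x - orth_proj (span B) x) s = 0" by auto
qed

text \<open>Compactness of the unit sphere of the span, then scaling. Used with k = 1 for coercivity
  of the loss and with k = 2 for the quadratic form of the rows.\<close>

lemma homogeneous_lower_bound:
  fixes f :: "'a::real_inner \<Rightarrow> real"
  assumes "finite B" "continuous_on UNIV f" "0 < k"
    and hom: "\<And>c x. 0 \<le> c \<Longrightarrow> f (c *\<^sub>R x) = c ^ k * f x"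
    and pos: "\<And>x. x \<in> span B \<Longrightarrow> x \<noteq> 0 \<Longrightarrow> 0 < f x"
  obtains \<delta> where "0 < \<delta>" "\<And>x. x \<in> span B \<Longrightarrow> \<delta> * norm x ^ k \<le> f x"
proof -
  define K where "K = {x \<in> span B. norm x \<le> 1} \<inter> {x. norm x = 1}"
  have "compact K" unfolding K_def
    by (intro compact_Int_closed compact_span_ball assms closed_Collect_eq continuous_intros)
  have normalize: "x /\<^sub>R norm x \<in> K" if "x \<in> span B" "x \<noteq> 0" for x
    using that by (auto simp: K_def intro: span_scale)
  obtain \<delta> where \<delta>: "0 < \<delta>" "\<And>x. x \<in> K \<Longrightarrow> \<delta> \<le> f x"
  proof (cases "K = {}")
    case False
    then obtain x0 where "x0 \<in> K" "\<And>x. x \<in> K \<Longrightarrow> f x0 \<le> f x"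
      using continuous_attains_inf[OF \<open>compact K\<close>, of f] continuous_on_subset[OF assms(2)] by blast
    with that[of "f x0"] pos[of x0] show ?thesis by (force simp: K_def)
  qed (auto intro: that[of 1])
  show ?thesis
  proof
    fix x assume x: "x \<in> span B"
    show "\<delta> * norm x ^ k \<le> f x"
    proof (cases "x = 0")
      case True
      with hom[of 0 0] \<open>0 < k\<close> show ?thesis by (simp add: power_0_left)
    next
      case False
      have "norm x ^ k * \<delta> \<le> norm x ^ k * f (x /\<^sub>R norm x)"
        using \<delta>(2)[OF normalize[OF x False]] by (intro mult_left_mono) auto
      also have "\<dots> = f (norm x *\<^sub>R (x /\<^sub>R norm x))" by (simp only: hom norm_ge_zero)
      finally show ?thesis using False by (simp add: mult.commute)
    qed
  qed fact
qed

text \<open>The separating vector v keeps 0 out of the hull; the inequality is the optimality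
  condition for the point nearest to 0.\<close>

lemma min_norm_point_convex_hull:
  fixes X :: "'a::real_inner set"
  assumes "finite X" "X \<noteq> {}" "\<And>a. a \<in> X \<Longrightarrow> inner a v < 0"
  obtains p where "p \<in> convex hull X" "p \<noteq> 0" "\<And>a. a \<in> X \<Longrightarrow> (norm p)\<^sup>2 \<le> inner a p"
proof -
  have compact: "compact (convex hull X)" using assms by (simp add: finite_imp_compact_convex_hull)
  moreover have "convex hull X \<noteq> {}" using assms by simp
  ultimately obtain p where p: "p \<in> convex hull X" "\<And>z. z \<in> convex hull X \<Longrightarrow> dist 0 p \<le> dist 0 z"
    using continuous_attains_inf[of "convex hull X" "dist 0"]
    by (auto intro!: continuous_intros)
  have "convex hull X \<subseteq> {x. inner v x < 0}"
    using assms by (intro hull_minimal convex_halfspace_lt) (auto simp: inner_commute)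
  with p(1) have "p \<noteq> 0" by auto
  moreover have "(norm p)\<^sup>2 \<le> inner a p" if "a \<in> X" for a
  proof -
    have "inner (0 - p) (a - p) \<le> 0"
      using compact p hull_inc[OF that]
      by (intro any_closest_point_dot[of "convex hull X"]) (auto simp: compact_imp_closed)
    then show ?thesis by (simp add: inner_diff_right dot_square_norm inner_commute)
  qed
  ultimately show ?thesis using that p(1) by blast
qed

section \<open>The loss on a balanced set of rows\<close>

lemma Loss_matvec: "Loss l (B \<odot> v) = (\<Sum>a\<leftarrow>B. l (inner a v))"
  by (simp add: Loss_def matvec_def comp_def)

lemma continuous_on_sum_list [continuous_intros]:
  fixes f :: "'b \<Rightarrow> 'a::topological_space \<Rightarrow> 'c::topological_monoid_add"
  assumes "\<And>i. i \<in> set is \<Longrightarrow> continuous_on A (f i)"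
  shows "continuous_on A (\<lambda>x. \<Sum>i\<leftarrow>is. f i x)"
  using assms by (induction "is") (auto intro!: continuous_intros)

text \<open>Every nonzero direction of the span raises some entry, which makes the loss coercive
  there. The condition is free of d and A because some constants have to be chosen from the list B
  before these are known.\<close>

definition balanced :: "rvec list \<Rightarrow> bool" where
  "balanced B \<longleftrightarrow> (\<forall>v\<in>span (set B). (\<forall>a\<in>set B. inner a v \<le> 0) \<longrightarrow> v = 0)"

context decaying_loss
begin

lemma loss_continuous: "continuous_on A l"
  using deriv1 by (meson DERIV_continuous_on DERIV_subset subset_UNIV has_field_derivative_at_within)

lemma Loss_continuous: "continuous_on A (\<lambda>v. Loss l (B \<odot> v))"
  unfolding Loss_matvec
  by (intro continuous_intros continuous_on_compose2[OF loss_continuous[of UNIV]]) auto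

lemma Loss_nonneg: "0 \<le> Loss l (B \<odot> v)"
  unfolding Loss_matvec using loss_pos by (intro sum_list_nonneg) (auto intro: less_imp_le)

text \<open>The positive part bounds the loss from below and is homogeneous; by balancedness its sum
  over the rows is positive away from 0 on the span.\<close>

lemma Loss_coercive:
  assumes "balanced B"
  obtains \<delta> where "0 < \<delta>" "\<And>v. v \<in> span (set B) \<Longrightarrow> \<delta> * norm v \<le> Loss l (B \<odot> v)"
proof -
  define f where "f v = (\<Sum>a\<leftarrow>B. max 0 (inner a v))" for v
  have "continuous_on UNIV f" unfolding f_def by (intro continuous_intros)
  moreover have "f (c *\<^sub>R x) = c ^ 1 * f x" if "0 \<le> c" for c x
  proof -
    have "max 0 (c * y) = c * max 0 y" for y
      using that by (simp add: max_mult_distrib_left)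
    then show ?thesis by (simp add: f_def sum_list_const_mult)
  qed
  moreover have "0 < f v" if v: "v \<in> span (set B)" "v \<noteq> 0" for v
  proof -
    obtain a where a: "a \<in> set B" "0 < inner a v"
      using v assms unfolding balanced_def by (meson not_le)
    then have "max 0 (inner a v) \<le> f v" unfolding f_def by (intro member_le_sum_list) force+
    with a show ?thesis by simp
  qed
  ultimately obtain \<delta> where "0 < \<delta>" "\<And>v. v \<in> span (set B) \<Longrightarrow> \<delta> * norm v ^ 1 \<le> f v"
    using homogeneous_lower_bound[of "set B" f 1] by (metis List.finite_set zero_less_one)
  moreover have "f v \<le> Loss l (B \<odot> v)" for v
    unfolding f_def Loss_matvec by (intro sum_list_mono pos_part_le)
  ultimately show ?thesis using that[of \<delta>] order_trans by (metis power_one_right)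
qed

lemma Loss_minimizer_exists:
  assumes "balanced B"
  shows "\<exists>v. is_arg_min (\<lambda>v. Loss l (B \<odot> v)) (\<lambda>v. v \<in> span (set B)) v"
proof -
  let ?L = "\<lambda>v. Loss l (B \<odot> v)"
  obtain \<delta> where \<delta>: "0 < \<delta>" "\<And>v. v \<in> span (set B) \<Longrightarrow> \<delta> * norm v \<le> ?L v"
    using Loss_coercive[OF assms] by blast
  define K where "K = {v \<in> span (set B). norm v \<le> ?L 0 / \<delta>}"
  have K0: "0 \<in> K" using \<delta>(1) Loss_nonneg by (simp add: K_def span_zero)
  have "compact K" unfolding K_def by (intro compact_span_ball) simp
  then obtain v where v: "v \<in> K" "\<And>x. x \<in> K \<Longrightarrow> ?L v \<le> ?L x"
    using continuous_attains_inf[of K ?L] K0 Loss_continuous by blast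
  have "?L v \<le> ?L x" if x: "x \<in> span (set B)" for x
  proof (cases "x \<in> K")
    case False
    then have "?L 0 < \<delta> * norm x" using x \<delta>(1) by (simp add: K_def field_simps)
    also have "\<dots> \<le> ?L x" using \<delta>(2) x by blast
    finally show ?thesis using v(2)[OF K0] by simp
  qed (use v in blast)
  with v(1) show ?thesis by (auto simp: is_arg_min_def K_def not_less)
qed

text \<open>The loss at the midpoint of v and \<open>v0\<close> is at least the minimum, so the
  midpoint gaps of the rows show up as excess loss of v. The bound r confines all entries to an
  interval with a uniform gap.\<close>

lemma Loss_quadratic_growth:
  assumes "v0 \<in> span (set B)" "\<And>v. v \<in> span (set B) \<Longrightarrow> Loss l (B \<odot> v0) \<le> Loss l (B \<odot> v)"
    and "\<And>a. a \<in> set B \<Longrightarrow> norm a \<le> 1"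
  obtains c where "0 < c" "\<And>v. v \<in> span (set B) \<Longrightarrow> norm v \<le> r \<Longrightarrow>
    c * (norm (v - v0))\<^sup>2 \<le> Loss l (B \<odot> v) - Loss l (B \<odot> v0)"
proof -
  define M where "M = max r (norm v0)"
  obtain c where c: "0 < c"
    "\<And>x y. \<bar>x\<bar> \<le> M \<Longrightarrow> \<bar>y\<bar> \<le> M \<Longrightarrow> l ((x + y) / 2) + c * (x - y)\<^sup>2 \<le> (l x + l y) / 2"
    using midpoint_gap[of M] by blast
  define f where "f v = (\<Sum>a\<leftarrow>B. (inner a v)\<^sup>2)" for v
  have "continuous_on UNIV f" unfolding f_def by (intro continuous_intros)
  moreover have "f (k *\<^sub>R x) = k\<^sup>2 * f x" for k x
    by (simp add: f_def sum_list_const_mult power_mult_distrib)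
  moreover have "0 < f v" if v: "v \<in> span (set B)" "v \<noteq> 0" for v
  proof -
    have "\<exists>a\<in>set B. inner v a \<noteq> 0"
    proof (rule ccontr)
      assume "\<not> ?thesis"
      then have "orthogonal v v" using v(1)
        by (intro orthogonal_to_span[of v "set B"]) (auto simp: orthogonal_def)
      with v(2) show False by (simp add: orthogonal_def)
    qed
    then obtain a where a: "a \<in> set B" "inner a v \<noteq> 0" by (auto simp: inner_commute)
    then have "(inner a v)\<^sup>2 \<le> f v" unfolding f_def by (intro member_le_sum_list) auto
    with a show ?thesis by (smt (verit) zero_less_power2)
  qed
  ultimately obtain \<kappa> where \<kappa>: "0 < \<kappa>" "\<And>v. v \<in> span (set B) \<Longrightarrow> \<kappa> * (norm v)\<^sup>2 \<le> f v"
    using homogeneous_lower_bound[of "set B" f 2] by (metis List.finite_set zero_less_numeral)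
  show ?thesis
  proof
    show "0 < 2 * c * \<kappa>" using c \<kappa> by simp
    fix v assume v: "v \<in> span (set B)" "norm v \<le> r"
    have "\<bar>inner a x\<bar> \<le> M" if "a \<in> set B" "norm x \<le> M" for a x
      using Cauchy_Schwarz_ineq2[of a x] mult_mono[OF assms(3)[OF that(1)] that(2)] that by auto
    then have gap: "l ((inner a v + inner a v0) / 2) + c * (inner a v - inner a v0)\<^sup>2
      \<le> (l (inner a v) + l (inner a v0)) / 2" if "a \<in> set B" for a
      using that v(2) by (intro c(2)) (auto simp: M_def)
    have "Loss l (B \<odot> v0) + c * f (v - v0) \<le> Loss l (B \<odot> ((v + v0) /\<^sub>R 2)) + c * f (v - v0)"
      using assms(1) v(1) by (intro add_right_mono assms(2) span_scale span_add)
    also have "\<dots> = (\<Sum>a\<leftarrow>B. l ((inner a v + inner a v0) / 2) + c * (inner a v - inner a v0)\<^sup>2)"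
      by (simp add: Loss_matvec f_def sum_list_addf sum_list_const_mult inner_simps field_simps)
    also have "\<dots> \<le> (\<Sum>a\<leftarrow>B. (l (inner a v) + l (inner a v0)) / 2)"
      by (intro sum_list_mono gap)
    also have "\<dots> = (Loss l (B \<odot> v) + Loss l (B \<odot> v0)) / 2"
      using sum_list_mult_const[of "\<lambda>a. l (inner a v) + l (inner a v0)" "1 / 2" B]
      by (simp add: Loss_matvec sum_list_addf)
    finally have "2 * c * f (v - v0) \<le> Loss l (B \<odot> v) - Loss l (B \<odot> v0)" by simp
    moreover have "2 * c * (\<kappa> * (norm (v - v0))\<^sup>2) \<le> 2 * c * f (v - v0)"
      using c(1) assms(1) v(1) by (intro mult_left_mono \<kappa>(2) span_diff) auto
    ultimately show "2 * c * \<kappa> * (norm (v - v0))\<^sup>2 \<le> Loss l (B \<odot> v) - Loss l (B \<odot> v0)"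
      by (simp add: mult_ac)
  qed
qed

end

section \<open>Gradient descent on the risk\<close>


lemma inner_sum_list_left: "inner (\<Sum>a\<leftarrow>A. f a) y = (\<Sum>a\<leftarrow>A. inner (f a) y)"
  by (induction A) (auto simp: inner_add_left)

lemma norm_sum_list_le:
  fixes f :: "'a \<Rightarrow> 'b::real_normed_vector"
  shows "norm (\<Sum>a\<leftarrow>A. f a) \<le> (\<Sum>a\<leftarrow>A. norm (f a))"
  by (induction A) (auto intro: norm_triangle_le)

lemma grad_eqI:
  assumes "GDERIV f x :> D"
  shows "grad f x = D"
  unfolding grad_def
proof (rule the_equality)
  fix D' assume "GDERIV f x :> D'"
  then have "(\<lambda>h. inner h D') = (\<lambda>h. inner h D)"
    using assms has_derivative_unique unfolding gderiv_def by blast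
  then have "inner (D' - D) D' = inner (D' - D) D" by metis
  then have "inner (D' - D) (D' - D) = 0" by (simp add: inner_diff_right)
  then show "D' = D" by simp
qed fact

lemma risk_eq: "risk l A w = (\<Sum>a\<leftarrow>A. l (inner a w)) / length A"
  by (simp add: risk_def Loss_matvec)

definition risk_grad :: "(real \<Rightarrow> real) \<Rightarrow> rvec list \<Rightarrow> rvec \<Rightarrow> rvec" where
  "risk_grad l' A w = (\<Sum>a\<leftarrow>A. l' (inner a w) *\<^sub>R a) /\<^sub>R length A"

lemma inner_risk_grad: "inner (risk_grad l' A w) v = (\<Sum>a\<leftarrow>A. l' (inner a w) * inner a v) / length A"
  by (simp add: risk_grad_def inner_sum_list_left divide_inverse mult.commute)

lemma (in decaying_loss) grad_risk: "grad (risk l A) w = risk_grad l' A w"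
proof (rule grad_eqI)
  have "((\<lambda>w. \<Sum>a\<leftarrow>A. l (inner a w)) has_derivative
      (\<lambda>h. \<Sum>a\<leftarrow>A. l' (inner a w) * inner a h)) (at w)"
  proof (induction A)
    case (Cons a A)
    have "((\<lambda>w. l (inner a w)) has_derivative (\<lambda>h. inner a h * l' (inner a w))) (at w)"
      by (rule DERIV_compose_FDERIV[OF deriv1]) (auto intro!: derivative_eq_intros)
    then show ?case
      using has_derivative_add[OF _ Cons] by (simp add: mult.commute)
  qed simp
  then have "(risk l A has_derivative (\<lambda>h. (\<Sum>a\<leftarrow>A. l' (inner a w) * inner a h) / length A)) (at w)"
    unfolding risk_eq[abs_def] divide_inverse by (rule has_derivative_mult_left)
  then show "GDERIV (risk l A) w :> risk_grad l' A w"
    by (simp add: gderiv_def inner_commute[of _ "risk_grad l' A w"] inner_risk_grad)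
qed

declare gd.simps(2) [simp del]

locale gradient_descent = decaying_loss +
  fixes A :: "rvec list" and \<eta> :: "nat \<Rightarrow> real"
  assumes nonempty: "A \<noteq> []"
    and norm_row_le: "a \<in> set A \<Longrightarrow> norm a \<le> 1"
    and step_pos: "0 < \<eta> j"
    and step_le: "\<eta> j \<le> 1"
begin

abbreviation n :: nat where "n \<equiv> length A"
abbreviation R :: "rvec \<Rightarrow> real" where "R \<equiv> risk l A"
abbreviation G :: "rvec \<Rightarrow> rvec" where "G \<equiv> risk_grad l' A"
abbreviation w :: "nat \<Rightarrow> rvec" where "w \<equiv> gd l A \<eta>"

lemma n_pos: "0 < n"
  using nonempty by simp

lemma w_Suc: "w (Suc j) = w j - \<eta> j *\<^sub>R G (w j)"
  by (simp add: gd.simps grad_risk)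

lemma inner_row_le: "a \<in> set A \<Longrightarrow> \<bar>inner a x\<bar> \<le> norm x"
  using Cauchy_Schwarz_ineq2[of a x] mult_right_mono[OF norm_row_le, of a "norm x"] by simp

lemma risk_above_tangent: "R x + inner (G x) (z - x) \<le> R z"
proof -
  have "(\<Sum>a\<leftarrow>A. l (inner a x) + l' (inner a x) * inner a (z - x)) \<le> (\<Sum>a\<leftarrow>A. l (inner a z))"
    using above_tangent by (intro sum_list_mono) (simp add: inner_diff_right)
  then have "(\<Sum>a\<leftarrow>A. l (inner a x) + l' (inner a x) * inner a (z - x)) / n \<le> (\<Sum>a\<leftarrow>A. l (inner a z)) / n"
    by (intro divide_right_mono) auto
  then show ?thesis
    by (simp add: risk_eq inner_risk_grad sum_list_addf add_divide_distrib)
qed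

lemma norm_G_le: "norm (G x) \<le> R x"
proof -
  have "norm (\<Sum>a\<leftarrow>A. l' (inner a x) *\<^sub>R a) \<le> (\<Sum>a\<leftarrow>A. norm (l' (inner a x) *\<^sub>R a))"
    by (rule norm_sum_list_le)
  also have "\<dots> \<le> (\<Sum>a\<leftarrow>A. l (inner a x))"
  proof (rule sum_list_mono)
    fix a assume "a \<in> set A"
    then show "norm (l' (inner a x) *\<^sub>R a) \<le> l (inner a x)"
      using first_le[of "inner a x"] first_pos[of "inner a x"] loss_pos[of "inner a x"]
        mult_mono[of "l' (inner a x)" "l (inner a x)" "norm a" 1] norm_row_le by simp
  qed
  finally show ?thesis
    by (simp add: risk_grad_def risk_eq divide_inverse mult.commute mult_left_mono)
qed

lemma risk_nonneg: "0 \<le> R x"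
  using norm_G_le[of x] norm_ge_zero[of "G x"] by linarith

lemma risk_0_le: "R 0 \<le> 1"
  using le_exp[of 0] n_pos by (simp add: risk_eq sum_list_triv)

text \<open>The exponential loss has no globally Lipschitz gradient, so curvature is measured by the
  risk at both ends of the step. As the risk of the new point is not known in advance, it is first
  shown not to increase; then both values are at most 1, and the error is at most half of the
  first-order gain.\<close>

lemma risk_step:
  assumes "R x \<le> 1" "0 \<le> h" "h \<le> 1"
  shows "R (x - h *\<^sub>R G x) \<le> R x - h / 2 * (norm (G x))\<^sup>2"
proof -
  let ?x = "x - h *\<^sub>R G x"
  define \<Gamma> where "\<Gamma> = (norm (G x))\<^sup>2"
  define q where "q = h\<^sup>2 * \<Gamma>"
  have row: "l (inner a ?x) \<le> l (inner a x) - h * (l' (inner a x) * inner a (G x))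
      + (q / 3 * l (inner a x) + q / 6 * l (inner a ?x))" if "a \<in> set A" for a
  proof -
    define s where "s = - h * inner a (G x)"
    have "s\<^sup>2 \<le> q"
      unfolding s_def q_def \<Gamma>_def power_mult_distrib
      using power_mono[OF inner_row_le[OF that, of "G x"], of 2] by (auto intro: mult_left_mono)
    then have "s\<^sup>2 * (l (inner a x) / 3 + l (inner a x + s) / 6) \<le> q * (l (inner a x) / 3 + l (inner a x + s) / 6)"
      using loss_pos[of "inner a x"] loss_pos[of "inner a x + s"] by (intro mult_right_mono) auto
    moreover have "inner a ?x = inner a x + s" by (simp add: s_def inner_diff_right)
    ultimately show ?thesis
      using relative_smoothness[of "inner a x" s] by (simp add: s_def algebra_simps)
  qed
  have "(\<Sum>a\<leftarrow>A. l (inner a ?x)) / n \<le> (\<Sum>a\<leftarrow>A. l (inner a x) - h * (l' (inner a x) * inner a (G x))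
      + (q / 3 * l (inner a x) + q / 6 * l (inner a ?x))) / n"
    by (intro divide_right_mono sum_list_mono row) auto
  also have "\<dots> = R x - h * inner (G x) (G x) + q * (R x / 3 + R ?x / 6)"
    unfolding risk_eq inner_risk_grad sum_list_addf sum_list_subtractf sum_list_const_mult
    using n_pos by (simp add: field_simps)
  finally have *: "R ?x \<le> R x - h * \<Gamma> + q * (R x / 3 + R ?x / 6)"
    by (simp add: risk_eq \<Gamma>_def power2_norm_eq_inner)
  have "h * h \<le> h * 1" using assms by (intro mult_left_mono) auto
  then have q: "0 \<le> q" "q \<le> h * \<Gamma>"
    by (auto simp: q_def \<Gamma>_def power2_eq_square intro: mult_right_mono)
  have "q * R x \<le> q * 1" using assms q by (intro mult_left_mono) auto
  \<comment> \<open>If the risk increased, \<open>1 - q / 6\<close> times the increase would be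
    positive and yet at most - h \<Gamma> + q / 2, which is not positive.\<close>
  have "R ?x \<le> R x"
  proof (rule ccontr)
    assume "\<not> R ?x \<le> R x"
    moreover have "norm (G x) \<le> 1" using norm_G_le assms(1) order_trans by blast
    then have "\<Gamma> \<le> 1" by (simp add: \<Gamma>_def power_le_one)
    then have "h * \<Gamma> \<le> 1" using assms(2,3) mult_le_one[of h \<Gamma>] by (simp add: \<Gamma>_def)
    then have "q < 6" using q by linarith
    ultimately have "0 < (1 - q / 6) * (R ?x - R x)" by (intro mult_pos_pos) auto
    then have "h * \<Gamma> < q * R x / 2" using * by (simp add: algebra_simps)
    with \<open>q * R x \<le> q * 1\<close> q show False by simp
  qed
  then have "q * R ?x \<le> q * R x" using q by (intro mult_left_mono)
  with * \<open>q * R x \<le> q * 1\<close> q show ?thesis by (simp add: \<Gamma>_def algebra_simps)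
qed

lemma risk_w_le_1: "R (w j) \<le> 1"
proof (induction j)
  case (Suc j)
  have "0 \<le> \<eta> j / 2 * (norm (G (w j)))\<^sup>2" using step_pos[of j] by simp
  moreover have "R (w j - \<eta> j *\<^sub>R G (w j)) \<le> R (w j) - \<eta> j / 2 * (norm (G (w j)))\<^sup>2"
    using Suc step_pos[of j] step_le[of j] by (intro risk_step) auto
  ultimately show ?case unfolding w_Suc using Suc by linarith
qed (simp add: risk_0_le)

lemma risk_descent: "R (w (Suc j)) \<le> R (w j) - \<eta> j / 2 * (norm (G (w j)))\<^sup>2"
  using risk_step[OF risk_w_le_1, of "\<eta> j" j] step_pos[of j] step_le[of j]
  by (simp only: w_Suc less_imp_le)

lemma risk_antimono: "i \<le> j \<Longrightarrow> R (w j) \<le> R (w i)"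
proof (rule lift_Suc_antimono_le)
  fix j
  have "0 \<le> \<eta> j / 2 * (norm (G (w j)))\<^sup>2" using step_pos[of j] by simp
  with risk_descent[of j] show "R (w (Suc j)) \<le> R (w j)" by linarith
qed

lemma step_square_le: "(norm (w (Suc j) - w j))\<^sup>2 \<le> 2 * \<eta> j * (R (w j) - R (w (Suc j)))"
proof -
  have "\<eta> j * (\<eta> j / 2 * (norm (G (w j)))\<^sup>2) \<le> \<eta> j * (R (w j) - R (w (Suc j)))"
    using risk_descent[of j] step_pos[of j] by (intro mult_left_mono) auto
  moreover have "(norm (w (Suc j) - w j))\<^sup>2 = (\<eta> j)\<^sup>2 * (norm (G (w j)))\<^sup>2"
    by (simp add: w_Suc power_mult_distrib)
  ultimately show ?thesis by (simp add: power2_eq_square)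
qed

text \<open>Telescoping the descent. This bounded total is the second-order error in the growth of
  the distance to S.\<close>

lemma sum_step_square_le: "(\<Sum>j<t. (norm (w (Suc j) - w j))\<^sup>2) \<le> 2"
proof -
  have "(norm (w (Suc j) - w j))\<^sup>2 \<le> 2 * (R (w j) - R (w (Suc j)))" for j
  proof -
    have "0 \<le> R (w j) - R (w (Suc j))" using risk_antimono[of j "Suc j"] by simp
    with step_le[of j] have "\<eta> j * (R (w j) - R (w (Suc j))) \<le> 1 * (R (w j) - R (w (Suc j)))"
      by (rule mult_right_mono)
    with step_square_le[of j] show ?thesis by simp
  qed
  then have "(\<Sum>j<t. (norm (w (Suc j) - w j))\<^sup>2) \<le> (\<Sum>j<t. 2 * (R (w j) - R (w (Suc j))))"
    by (intro sum_mono)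
  also have "\<dots> = 2 * (R (w 0) - R (w t))"
    by (simp only: sum_distrib_left[symmetric] sum_lessThan_telescope'[of "\<lambda>j. R (w j)" t])
  also have "\<dots> \<le> 2" using risk_0_le risk_nonneg[of "w t"] by simp
  finally show ?thesis .
qed

text \<open>Convexity yields the gap to R(w_j); by the descent inequality the squared step length
  costs no more than exchanging R(w_j) for R(w_{j+1}).\<close>

lemma dist_step:
  "(norm (w (Suc j) - z))\<^sup>2 \<le> (norm (w j - z))\<^sup>2 + 2 * \<eta> j * (R z - R (w (Suc j)))"
proof -
  have "w (Suc j) - z = (w j - z) + (w (Suc j) - w j)" by simp
  then have "(norm (w (Suc j) - z))\<^sup>2
      = (norm (w j - z))\<^sup>2 + 2 * inner (w j - z) (w (Suc j) - w j) + (norm (w (Suc j) - w j))\<^sup>2"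
    by (simp only: power2_norm_eq_inner inner_add_left inner_add_right inner_commute)
  also have "inner (w j - z) (w (Suc j) - w j) = \<eta> j * inner (G (w j)) (z - w j)"
    by (simp only: w_Suc) (simp add: inner_diff_right inner_diff_left inner_commute algebra_simps)
  also have "\<dots> \<le> \<eta> j * (R z - R (w j))"
    using risk_above_tangent[of "w j" z] step_pos[of j] by (intro mult_left_mono) auto
  finally show ?thesis using step_square_le[of j] by (simp add: algebra_simps)
qed

lemma dist_le:
  "(norm (w t - z))\<^sup>2 \<le> (norm z)\<^sup>2 + 2 * (\<Sum>j<t. \<eta> j) * (R z - R (w t))"
proof -
  have "(norm (w s - z))\<^sup>2 \<le> (norm z)\<^sup>2 + 2 * (\<Sum>j<s. \<eta> j) * (R z - R (w t))" if "s \<le> t" for s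
    using that
  proof (induction s)
    case (Suc s)
    have "\<eta> s * (R z - R (w (Suc s))) \<le> \<eta> s * (R z - R (w t))"
      using risk_antimono[OF Suc.prems] step_pos[of s] by (intro mult_left_mono) auto
    with Suc dist_step[of s z] show ?case by (simp add: algebra_simps)
  qed simp
  then show ?thesis by simp
qed

text \<open>While the risk stays above that of z, no step increases the distance to z, which is |z|
  at the start.\<close>

lemma norm_w_le_of_lower_risk:
  assumes "R z \<le> R (w t)"
  shows "norm (w t) \<le> 2 * norm z"
proof -
  have "0 \<le> (\<Sum>j<t. \<eta> j)" using step_pos by (intro sum_nonneg) (auto intro: less_imp_le)
  then have "(\<Sum>j<t. \<eta> j) * (R z - R (w t)) \<le> 0"
    using assms by (simp add: mult_nonneg_nonpos)
  with dist_le[of t z] have "(norm (w t - z))\<^sup>2 \<le> (norm z)\<^sup>2" by linarith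
  then have "norm (w t - z) \<le> norm z" by (rule power2_le_imp_le) simp
  then show ?thesis using norm_triangle_sub[of "w t" z] by linarith
qed

lemma norm_w_le_twice: "j \<le> t \<Longrightarrow> norm (w j) \<le> 2 * norm (w t)"
  using norm_w_le_of_lower_risk risk_antimono by blast

lemma w_in_span: "w j \<in> span (set A)"
proof (induction j)
  case (Suc j)
  have "(\<Sum>a\<leftarrow>B. f a *\<^sub>R a) \<in> span (set B)" for f and B :: "rvec list"
  proof (induction B)
    case (Cons b B)
    then have "(\<Sum>a\<leftarrow>B. f a *\<^sub>R a) \<in> span (set (b # B))"
      using span_mono[of "set B" "set (b # B)"] by auto
    then show ?case by (auto intro: span_add span_scale span_base)
  qed (simp add: span_zero)
  then show ?case
    using Suc unfolding w_Suc risk_grad_def by (intro span_diff span_scale)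
qed (simp add: span_zero)

end

section \<open>The margin and its dual\<close>


lemma subspace_Rd: "subspace (Rd d)"
  by (auto simp: Rd_def subspace_def)

lemma S_span: "S d A = span (set (As d A))"
  by (simp add: S_def)

lemma subspace_S: "subspace (S d A)"
  by (simp add: S_span)

lemma
  shows proj_S_mem: "orth_proj (S d A) x \<in> S d A"
    and proj_S_inner: "s \<in> S d A \<Longrightarrow> inner (x - orth_proj (S d A) x) s = 0"
  by (simp_all add: S_span orth_proj_span_mem orth_proj_span_inner)

lemma inner_proj_S: "s \<in> S d A \<Longrightarrow> inner s (orth_proj (S d A) x) = inner s x"
  using proj_S_inner[of s d A x] by (simp add: inner_diff_left inner_commute[of s])

lemma norm_proj_S_pythagoras:
  "(norm x)\<^sup>2 = (norm (orth_proj (S d A) x))\<^sup>2 + (norm (x - orth_proj (S d A) x))\<^sup>2"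
  using norm_add_Pythagorean[of "orth_proj (S d A) x" "x - orth_proj (S d A) x"]
    proj_S_inner[OF proj_S_mem, of x d A] by (simp add: orthogonal_def inner_commute)

lemma norm_proj_S_le: "norm (orth_proj (S d A) x) \<le> norm x"
  by (rule power2_le_imp_le) (metis norm_proj_S_pythagoras le_add_same_cancel1 zero_le_power2, simp)

lemma dist_proj_S_le:
  assumes "s \<in> S d A"
  shows "norm (x - orth_proj (S d A) x) \<le> norm (x - s)"
proof -
  let ?p = "orth_proj (S d A) x"
  have "?p - s \<in> S d A" using assms proj_S_mem subspace_S subspace_diff by blast
  then have "(norm ((x - ?p) + (?p - s)))\<^sup>2 = (norm (x - ?p))\<^sup>2 + (norm (?p - s))\<^sup>2"
    by (intro norm_add_Pythagorean) (simp add: orthogonal_def proj_S_inner)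
  then have "(norm (x - ?p))\<^sup>2 \<le> (norm (x - s))\<^sup>2" by simp
  then show ?thesis by (rule power2_le_imp_le) simp
qed

lemma set_As_Ac: "set (As d A) \<subseteq> set A" "set (Ac d A) \<subseteq> set A" "set A = set (As d A) \<union> set (Ac d A)"
  by (auto simp: As_def Ac_def)

lemma sum_list_As_Ac:
  fixes f :: "rvec \<Rightarrow> real"
  shows "(\<Sum>a\<leftarrow>A. f a) = (\<Sum>a\<leftarrow>As d A. f a) + (\<Sum>a\<leftarrow>Ac d A. f a)"
proof -
  have "(\<Sum>a\<leftarrow>L. f a) = (\<Sum>a\<leftarrow>filter (\<lambda>a. \<not> P a) L. f a) + (\<Sum>a\<leftarrow>filter P L. f a)" for P L
    by (induction L) auto
  then show ?thesis unfolding As_def Ac_def .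
qed

lemma length_As_Ac: "length A = length (As d A) + length (Ac d A)"
  by (simp add: As_def Ac_def add.commute sum_length_filter_compl)

locale data =
  fixes d :: nat and A :: "rvec list"
  assumes data: "data_matrix d A"
begin

abbreviation \<pi> :: "rvec \<Rightarrow> rvec" where "\<pi> \<equiv> orth_proj (S d A)"
abbreviation \<gamma> :: real where "\<gamma> \<equiv> margin d A"
abbreviation u :: rvec where "u \<equiv> ubar d A"

lemma row_Rd: "a \<in> set A \<Longrightarrow> a \<in> Rd d"
  and row_norm: "a \<in> set A \<Longrightarrow> norm a \<le> 1"
  and rows_nonempty: "A \<noteq> []"
  using data by (auto simp: data_matrix_def)

lemma S_subset_Rd: "S d A \<subseteq> Rd d"
  unfolding S_span using row_Rd set_As_Ac by (intro span_minimal subspace_Rd) blast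

lemma As_in_S: "a \<in> set (As d A) \<Longrightarrow> a \<in> S d A"
  by (simp add: S_span span_base)

lemma subspace_Sperp: "subspace (Sperp d A)"
  unfolding Sperp_def by (intro subspace_inter subspace_Rd subspace_orthogonal_comp)

lemma residual_mem_Sperp:
  assumes "x \<in> Rd d"
  shows "x - \<pi> x \<in> Sperp d A"
proof -
  have "\<pi> x \<in> Rd d" using proj_S_mem S_subset_Rd by blast
  then have "x - \<pi> x \<in> Rd d" using assms subspace_Rd subspace_diff by blast
  then show ?thesis
    using proj_S_inner[of _ d A x]
    by (simp add: Sperp_def orthogonal_comp_def orthogonal_def inner_commute)
qed

lemma proj_Sperp:
  assumes "x \<in> Rd d"
  shows "orth_proj (Sperp d A) x = x - \<pi> x"
proof (rule orth_proj_eqI[OF subspace_Sperp residual_mem_Sperp[OF assms]])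
  fix s assume "s \<in> Sperp d A"
  then show "inner (x - (x - \<pi> x)) s = 0"
    using proj_S_mem[of d A x] by (auto simp: Sperp_def orthogonal_comp_def orthogonal_def)
qed

lemma As_row_zero:
  assumes "x \<in> Rd d" "\<And>a. a \<in> set A \<Longrightarrow> inner a x \<le> 0" "a \<in> set (As d A)"
  shows "inner a x = 0"
proof -
  have "\<not> in_Ac d A a" "a \<in> set A" using assms(3) by (auto simp: As_def)
  moreover have "\<forall>z\<in>set (A \<odot> x). z \<le> 0" using assms(2) by (auto simp: matvec_def)
  ultimately show ?thesis using assms by (auto simp: in_Ac_def intro: antisym simp: not_less)
qed

text \<open>Each row of \<open>A_c\<close> comes with a witness x such that
  \<open>A x \<le> 0\<close>. Adding witnesses keeps this and makes all rows of \<open>A_c\<close>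
  negative at once; on the rows of \<open>A_S\<close> such a sum must vanish, so it is orthogonal to
  S.\<close>

lemma Ac_descent_direction:
  obtains x where "x \<in> Sperp d A" "\<And>a. a \<in> set (Ac d A) \<Longrightarrow> inner a x < 0"
proof -
  have "\<exists>x\<in>Rd d. (\<forall>b\<in>set A. inner b x \<le> 0) \<and> (\<forall>a\<in>set L. inner a x < 0)"
    if "set L \<subseteq> set (Ac d A)" for L
    using that
  proof (induction L)
    case Nil
    then show ?case using subspace_0[OF subspace_Rd] by (intro bexI[of _ 0]) auto
  next
    case (Cons a L)
    then obtain x where x: "x \<in> Rd d" "\<And>b. b \<in> set A \<Longrightarrow> inner b x \<le> 0" "\<And>a. a \<in> set L \<Longrightarrow> inner a x < 0"
      by auto
    have "in_Ac d A a" using Cons.prems by (auto simp: Ac_def)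
    then obtain y where y: "y \<in> Rd d" "\<And>b. b \<in> set A \<Longrightarrow> inner b y \<le> 0" "inner a y < 0"
      by (auto simp: in_Ac_def matvec_def)
    have L: "set (a # L) \<subseteq> set A" using Cons.prems set_As_Ac by blast
    have "inner b (x + y) < 0" if "b \<in> set (a # L)" for b
      using that x(3)[of b] y(2)[of b] x(2)[of b] y(3) L by (auto simp: inner_add_right)
    moreover have "inner b (x + y) \<le> 0" if "b \<in> set A" for b
      using x(2)[OF that] y(2)[OF that] by (simp add: inner_add_right)
    ultimately show ?case using x(1) y(1) subspace_add[OF subspace_Rd] by blast
  qed
  from this[of "Ac d A"] obtain x where x: "x \<in> Rd d" "\<And>b. b \<in> set A \<Longrightarrow> inner b x \<le> 0"
    "\<And>a. a \<in> set (Ac d A) \<Longrightarrow> inner a x < 0" by auto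
  have "orthogonal x a" if "a \<in> set (As d A)" for a
    using As_row_zero[OF x(1,2) that] by (simp add: orthogonal_def inner_commute)
  then have "orthogonal x s" if "s \<in> S d A" for s
    using orthogonal_to_span that unfolding S_span by blast
  then have "x \<in> Sperp d A"
    using x(1) by (auto simp: Sperp_def orthogonal_comp_def orthogonal_commute)
  with x(3) that show ?thesis by blast
qed

text \<open>A large multiple of the descent direction corrects v on \<open>A_c\<close> without
  affecting \<open>A_S\<close>. The sum is nonpositive on all rows, hence zero on
  \<open>A_S\<close>, and so v is orthogonal to the span that contains it.\<close>

lemma balanced_As: "balanced (As d A)"
  unfolding balanced_def
proof (intro ballI impI)
  fix v assume v: "v \<in> span (set (As d A))" "\<forall>a\<in>set (As d A). inner a v \<le> 0"
  obtain x where x: "x \<in> Sperp d A" "\<And>a. a \<in> set (Ac d A) \<Longrightarrow> inner a x < 0"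
    using Ac_descent_direction by blast
  have xS: "inner a x = 0" if "a \<in> set (As d A)" for a
    using x(1) As_in_S[OF that] by (auto simp: Sperp_def orthogonal_comp_def orthogonal_def)
  obtain M where M: "\<And>a. a \<in> set (Ac d A) \<Longrightarrow> inner a v / - inner a x \<le> M"
    using finite_imageI[of "set (Ac d A)" "\<lambda>a. inner a v / - inner a x"]
    by (metis (no_types, lifting) List.finite_set Max_ge imageI)
  define y where "y = v + M *\<^sub>R x"
  have "v \<in> Rd d" "x \<in> Rd d" using v(1) S_subset_Rd x(1) by (auto simp: S_span Sperp_def)
  then have "y \<in> Rd d" unfolding y_def using subspace_Rd subspace_add subspace_scale by blast
  moreover have "inner a y \<le> 0" if "a \<in> set A" for a
  proof (cases "a \<in> set (Ac d A)")
    case True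
    then show ?thesis using M[OF True] x(2)[OF True] by (simp add: y_def inner_add_right field_simps)
  next
    case False
    then have "a \<in> set (As d A)" using that set_As_Ac(3)[of A d] by auto
    then show ?thesis using v(2) xS by (simp add: y_def inner_add_right)
  qed
  ultimately have "inner a y = 0" if "a \<in> set (As d A)" for a
    using As_row_zero that by blast
  then have "orthogonal v a" if "a \<in> set (As d A)" for a
    using that xS by (simp add: y_def inner_add_right orthogonal_def inner_commute)
  then have "orthogonal v v" using orthogonal_to_span v(1) by blast
  then show "v = 0" by (simp add: orthogonal_def)
qed

text \<open>The vector \<open>p\<close> of least norm in the convex hull of the rows of \<open>A_perp\<close> solves the problem dual
  to the margin problem: the margin is \<open>|p|\<close> and is attained at \<open>- p / |p|\<close> only.\<close>

lemma margin_dual: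
  assumes "Ac d A \<noteq> []"
  obtains p where "p \<in> Sperp d A" "p \<noteq> 0" "norm p \<le> 1" "\<gamma> = norm p" "u = - p /\<^sub>R norm p"
    "\<And>a. a \<in> set (Ac d A) \<Longrightarrow> (norm p)\<^sup>2 \<le> inner (a - \<pi> a) p"
    "\<And>x. \<exists>a\<in>set (Ac d A). inner p x \<le> inner (a - \<pi> a) x"
proof -
  define X where "X = set (Aperp d A)"
  have Ac_Rd: "a \<in> Rd d" "norm a \<le> 1" if "a \<in> set (Ac d A)" for a
    using that row_Rd row_norm set_As_Ac by blast+
  have X: "X = (\<lambda>a. a - \<pi> a) ` set (Ac d A)"
    using Ac_Rd proj_Sperp by (auto simp: X_def Aperp_def)
  have "finite X" "X \<noteq> {}" using assms by (auto simp: X)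
  have XS: "X \<subseteq> Sperp d A"
    using Ac_Rd residual_mem_Sperp by (auto simp: X)
  obtain x0 where x0: "x0 \<in> Sperp d A" "\<And>a. a \<in> set (Ac d A) \<Longrightarrow> inner a x0 < 0"
    using Ac_descent_direction by blast
  have "inner (\<pi> a) x0 = 0" for a
    using x0(1) proj_S_mem[of d A a] by (auto simp: Sperp_def orthogonal_comp_def orthogonal_def)
  then have "inner x x0 < 0" if "x \<in> X" for x
    using that x0(2) by (auto simp: X inner_diff_left)
  from min_norm_point_convex_hull[OF \<open>finite X\<close> \<open>X \<noteq> {}\<close> this] obtain p
    where p: "p \<in> convex hull X" "p \<noteq> 0" "\<And>x. x \<in> X \<Longrightarrow> (norm p)\<^sup>2 \<le> inner x p" by blast
  define u0 where "u0 = - p /\<^sub>R norm p"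
  have "convex hull X \<subseteq> Sperp d A"
    using XS by (intro hull_minimal subspace_imp_convex subspace_Sperp)
  with p have pS: "p \<in> Sperp d A" by blast
  have "X \<subseteq> cball 0 1"
  proof
    fix x assume "x \<in> X"
    then obtain a where a: "a \<in> set (Ac d A)" "x = a - \<pi> a" unfolding X by blast
    have "norm x \<le> norm (a - 0)"
      unfolding a(2) by (rule dist_proj_S_le[OF subspace_0[OF subspace_S]])
    with Ac_Rd(2)[OF a(1)] show "x \<in> cball 0 1" by simp
  qed
  then have "convex hull X \<subseteq> cball 0 1" by (intro hull_minimal) auto
  with p have p1: "norm p \<le> 1" by auto
  have Max_eq: "max_entry (Aperp d A \<odot> x) = Max ((\<lambda>a. inner a x) ` X)" for x
    by (simp add: max_entry_def matvec_def X_def)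
  \<comment> \<open>Weak duality: at a point of the hull a linear functional is at most its maximum
    over the generators.\<close>
  have Max_ge: "inner p x \<le> max_entry (Aperp d A \<odot> x)" for x
  proof -
    have "inner x y \<le> max_entry (Aperp d A \<odot> x)" if "y \<in> X" for y
      unfolding Max_eq using that \<open>finite X\<close> by (subst inner_commute) (intro Max_ge; simp)
    then have "convex hull X \<subseteq> {y. inner x y \<le> max_entry (Aperp d A \<odot> x)}"
      by (intro hull_minimal convex_halfspace_le) auto
    with p(1) show ?thesis by (auto simp: inner_commute)
  qed
  have u0: "u0 \<in> Rd d" "norm u0 = 1"
    using pS p(2) subspace_scale[OF subspace_Rd, of p d "- inverse (norm p)"]
    by (auto simp: u0_def Sperp_def)
  have pu0: "inner x u0 = - inner x p / norm p" for x
    by (simp add: u0_def divide_inverse mult.commute)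
  have max_u0: "max_entry (Aperp d A \<odot> u0) = - norm p"
  proof (rule antisym)
    have "inner x u0 \<le> - norm p" if "x \<in> X" for x
      using p(3)[OF that] p(2) by (simp add: pu0 power2_eq_square divide_simps)
    then show "max_entry (Aperp d A \<odot> u0) \<le> - norm p"
      unfolding Max_eq using \<open>finite X\<close> \<open>X \<noteq> {}\<close> by simp
    show "- norm p \<le> max_entry (Aperp d A \<odot> u0)"
      using Max_ge[of u0] p(2) by (simp add: pu0 dot_square_norm power2_eq_square)
  qed
  have lower: "- norm p \<le> max_entry (Aperp d A \<odot> x)" if "norm x = 1" for x
    using Max_ge[of x] Cauchy_Schwarz_ineq2[of p x] that by simp
  have "\<gamma> = norm p"
  proof -
    have "(INF x\<in>{x \<in> Rd d. norm x = 1}. max_entry (Aperp d A \<odot> x)) = - norm p"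
      using u0 max_u0 lower by (intro cInf_eq_minimum) (auto intro!: image_eqI[of _ _ u0])
    then show ?thesis by (simp add: margin_def)
  qed
  moreover have "u = u0"
  proof -
    \<comment> \<open>\<open>ubar\<close> is an unspecified minimizer, so uniqueness has to be
      derived: any minimizer has inner product at least 1 with the unit vector \<open>u0\<close>,
      which forces equality.\<close>
    let ?P = "\<lambda>x. x \<in> Rd d \<and> norm x = 1"
    have "is_arg_min (\<lambda>x. max_entry (Aperp d A \<odot> x)) ?P u0"
      using u0 max_u0 lower by (auto simp: is_arg_min_def not_less)
    then have "is_arg_min (\<lambda>x. max_entry (Aperp d A \<odot> x)) ?P u"
      unfolding ubar_def arg_min_def by (rule someI)
    then have u: "norm u = 1" "max_entry (Aperp d A \<odot> u) \<le> - norm p"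
      using u0 max_u0 by (auto simp: is_arg_min_def not_less)
    have "inner u p \<le> - norm p" using Max_ge[of u] u(2) by (simp add: inner_commute)
    then have "1 \<le> inner u u0" using p(2) by (simp add: pu0 divide_simps)
    moreover have "inner u u = 1" "inner u0 u0 = 1" using u(1) u0(2) by (simp_all add: dot_square_norm)
    ultimately have "inner (u - u0) (u - u0) \<le> 0"
      by (simp add: inner_diff_left inner_diff_right inner_commute)
    then show ?thesis by (metis inner_ge_zero inner_eq_zero_iff antisym eq_iff_diff_eq_0)
  qed
  moreover have "(norm p)\<^sup>2 \<le> inner (a - \<pi> a) p" if "a \<in> set (Ac d A)" for a
    using that p(3) X by blast
  moreover have "\<exists>a\<in>set (Ac d A). inner p x \<le> inner (a - \<pi> a) x" for x
  proof -
    have "Max ((\<lambda>a. inner a x) ` X) \<in> (\<lambda>a. inner a x) ` X"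
      using \<open>finite X\<close> \<open>X \<noteq> {}\<close> by (intro Max_in) auto
    then show ?thesis using Max_ge[of x] unfolding Max_eq X by auto
  qed
  ultimately show ?thesis using that pS p(2) p1 by (simp add: u0_def)
qed

context
  assumes Ac_nonempty: "Ac d A \<noteq> []"
begin

lemma margin_pos: "0 < \<gamma>"
  using margin_dual[OF Ac_nonempty] by (metis zero_less_norm_iff)

lemma margin_le: "\<gamma> \<le> 1"
  using margin_dual[OF Ac_nonempty] by metis

lemma norm_ubar: "norm u = 1"
proof -
  obtain p where "p \<noteq> 0" "u = - p /\<^sub>R norm p" using margin_dual[OF Ac_nonempty] by metis
  then show ?thesis by simp
qed

lemma ubar_Sperp: "u \<in> Sperp d A"
proof -
  obtain p where "p \<in> Sperp d A" "u = - p /\<^sub>R norm p" using margin_dual[OF Ac_nonempty] by metis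
  then show ?thesis using subspace_scale[OF subspace_Sperp] subspace_neg[OF subspace_Sperp] by metis
qed

lemma inner_S_ubar: "s \<in> S d A \<Longrightarrow> inner s u = 0"
  using ubar_Sperp by (auto simp: Sperp_def orthogonal_comp_def orthogonal_def)

lemma Ac_inner_ubar:
  assumes "a \<in> set (Ac d A)"
  shows "inner a u \<le> - \<gamma>"
proof -
  obtain p where p: "p \<noteq> 0" "\<gamma> = norm p" "u = - p /\<^sub>R norm p" "(norm p)\<^sup>2 \<le> inner (a - \<pi> a) p"
    using margin_dual[OF Ac_nonempty] assms by metis
  have "inner a u = inner (a - \<pi> a) u"
    using inner_S_ubar[OF proj_S_mem] by (simp add: inner_diff_left)
  also have "\<dots> = - (inner (a - \<pi> a) p / norm p)" using p(3) by (simp add: divide_inverse)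
  also have "\<dots> \<le> - norm p" using p by (simp add: power2_eq_square divide_simps)
  finally show ?thesis using p(2) by simp
qed

text \<open>The dual point p is an average of projected rows and has inner product
  \<open>- \<gamma> * inner x u\<close> with x, so some projected row has at least this value.
  Restoring the S-component of the row costs at most |\<pi> x|.\<close>

lemma exists_Ac_row_ge: "\<exists>a\<in>set (Ac d A). - \<gamma> * inner x u - norm (\<pi> x) \<le> inner a x"
proof -
  obtain p where p: "p \<noteq> 0" "\<gamma> = norm p" "u = - p /\<^sub>R norm p"
    "\<And>x. \<exists>a\<in>set (Ac d A). inner p x \<le> inner (a - \<pi> a) x"
    using margin_dual[OF Ac_nonempty] by metis
  then obtain a where a: "a \<in> set (Ac d A)" "inner p x \<le> inner (a - \<pi> a) x" by blast
  have "inner x u = - inner p x / \<gamma>"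
    unfolding p(3) p(2) by (simp add: divide_inverse inner_commute)
  then have "inner p x = - \<gamma> * inner x u" using p(1,2) by simp
  moreover have "\<bar>inner (\<pi> a) x\<bar> \<le> norm (\<pi> x)"
  proof -
    have "\<bar>inner (\<pi> a) x\<bar> = \<bar>inner (\<pi> a) (\<pi> x)\<bar>" by (simp add: inner_proj_S proj_S_mem)
    also have "\<dots> \<le> norm (\<pi> a) * norm (\<pi> x)" by (rule Cauchy_Schwarz_ineq2)
    also have "\<dots> \<le> 1 * norm (\<pi> x)"
      using a(1) row_norm set_As_Ac norm_proj_S_le order_trans by (intro mult_right_mono) (blast, simp)
    finally show ?thesis by simp
  qed
  ultimately show ?thesis using a by (auto simp: inner_diff_left intro!: bexI[of _ a])
qed

end

lemma separable_decomposition: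
  assumes "separable d A"
  shows "As d A = []" "Ac d A = A" "S d A = {0}" "Sperp d A = Rd d" "Aperp d A = A"
proof -
  obtain x where "x \<in> Rd d" "\<forall>z\<in>set (A \<odot> x). z < 0" using assms by (auto simp: separable_def)
  then have "in_Ac d A a" if "a \<in> set A" for a
    using that unfolding in_Ac_def by (intro bexI[of _ x]) (auto simp: matvec_def)
  then show *: "As d A = []" "Ac d A = A" by (auto simp: As_def Ac_def filter_id_conv filter_empty_conv)
  then show S: "S d A = {0}" by (simp add: S_span)
  then show Sp: "Sperp d A = Rd d" by (simp add: Sperp_def)
  have "orth_proj (Rd d) a = a" if "a \<in> set A" for a
    using row_Rd[OF that] by (intro orth_proj_eqI subspace_Rd) auto
  then show "Aperp d A = A" by (simp add: Aperp_def * Sp map_idI)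
qed

end

section \<open>Motion along the margin direction\<close>


lemma dir_error_le_4:
  assumes "norm (ubar d A) = 1"
  shows "dir_error d A x \<le> 4"
proof -
  have "norm (x /\<^sub>R norm x) \<le> 1" by (cases "x = 0") auto
  then have "norm (x /\<^sub>R norm x - ubar d A) \<le> 2"
    using norm_triangle_ineq4[of "x /\<^sub>R norm x" "ubar d A"] assms by linarith
  then have "(norm (x /\<^sub>R norm x - ubar d A))\<^sup>2 \<le> 2\<^sup>2" by (intro power_mono) auto
  then show ?thesis by (simp add: dir_error_def)
qed

lemma dir_error_eq:
  assumes "norm (ubar d A) = 1" "x \<noteq> 0"
  shows "dir_error d A x = 2 - 2 * (inner x (ubar d A) / norm x)"
proof -
  have "inner (x /\<^sub>R norm x) (x /\<^sub>R norm x) = 1"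
    using assms(2) by (simp only: dot_square_norm) simp
  moreover have "inner (ubar d A) (ubar d A) = 1" using assms(1) by (simp add: dot_square_norm)
  moreover have "dir_error d A x = inner (x /\<^sub>R norm x) (x /\<^sub>R norm x)
      - 2 * inner (x /\<^sub>R norm x) (ubar d A) + inner (ubar d A) (ubar d A)"
    unfolding dir_error_def power2_norm_eq_inner by (simp add: inner_diff_left inner_diff_right inner_commute)
  ultimately show ?thesis by (simp add: divide_inverse mult.commute)
qed

locale data_descent = data d A + gradient_descent l l' l'' A \<eta>
  for d l l' l'' A \<eta>
begin

abbreviation v0 :: rvec where "v0 \<equiv> vbar l d A"
abbreviation L0 :: real where "L0 \<equiv> Loss l (As d A \<odot> v0)"

lemma ln_n_nonneg: "0 \<le> ln (real n)"
  using Suc_leI[OF n_pos] by (intro ln_ge_zero) linarith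

lemma
  shows vbar_mem: "v0 \<in> S d A"
    and vbar_min: "v \<in> S d A \<Longrightarrow> L0 \<le> Loss l (As d A \<odot> v)"
proof -
  have "is_arg_min (\<lambda>v. Loss l (As d A \<odot> v)) (\<lambda>v. v \<in> S d A) v0"
    unfolding vbar_def arg_min_def
    using Loss_minimizer_exists[OF balanced_As] unfolding S_span by (rule someI_ex)
  then show "v0 \<in> S d A" "v \<in> S d A \<Longrightarrow> L0 \<le> Loss l (As d A \<odot> v)"
    by (auto simp: is_arg_min_def not_less)
qed

lemma inner_As_proj: "a \<in> set (As d A) \<Longrightarrow> inner a (\<pi> x) = inner a x"
  by (simp add: inner_proj_S As_in_S)

lemma Loss_As_proj: "Loss l (As d A \<odot> \<pi> x) = Loss l (As d A \<odot> x)"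
  unfolding Loss_matvec by (intro arg_cong[where f = sum_list] map_cong) (auto simp: inner_As_proj)

lemma n_risk: "n * R x = Loss l (As d A \<odot> x) + Loss l (Ac d A \<odot> x)"
  using n_pos by (simp add: risk_eq Loss_matvec sum_list_As_Ac[of _ A d])

lemma Loss_As_le_risk: "Loss l (As d A \<odot> \<pi> x) \<le> n * R x"
  using Loss_nonneg[of "Ac d A" x] by (simp add: n_risk Loss_As_proj)

lemma Loss_Ac_le_risk: "Loss l (Ac d A \<odot> x) \<le> n * R x - L0"
  using vbar_min[OF proj_S_mem, of x] by (simp add: n_risk Loss_As_proj)

text \<open>Conventions for an empty \<open>A_c\<close>, under which both cases share the same comparison points.\<close>

definition esc :: rvec where "esc = (if Ac d A = [] then 0 else u)"
definition rate :: real where "rate = (if Ac d A = [] then 1 else \<gamma>)"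

lemma rate_pos: "0 < rate" and rate_le: "rate \<le> 1" and norm_esc: "norm esc \<le> 1"
  using margin_pos margin_le norm_ubar by (auto simp: rate_def esc_def)

lemma inner_esc_As: "a \<in> set (As d A) \<Longrightarrow> inner a esc = 0"
  using inner_S_ubar As_in_S by (auto simp: esc_def)

lemma inner_esc_Ac: "a \<in> set (Ac d A) \<Longrightarrow> inner a esc \<le> - rate"
  using Ac_inner_ubar by (auto simp: esc_def rate_def)

lemma norm_comparator_le: "0 \<le> r \<Longrightarrow> norm (v0 + r *\<^sub>R esc) \<le> norm v0 + r"
  using norm_triangle_ineq[of v0 "r *\<^sub>R esc"] mult_left_mono[OF norm_esc, of r] by simp

lemma comparator_Rd: "v0 + r *\<^sub>R esc \<in> Rd d"
proof -
  have "v0 \<in> Rd d" using vbar_mem S_subset_Rd by blast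
  moreover have "esc \<in> Rd d"
    using ubar_Sperp subspace_0[OF subspace_Rd] by (auto simp: esc_def Sperp_def)
  ultimately show ?thesis using subspace_Rd subspace_add subspace_scale by blast
qed

text \<open>Along \<open>esc\<close> the rows of \<open>A_S\<close> are constant, and those of
  \<open>A_c\<close> decrease at least at speed \<open>rate\<close>.\<close>

lemma risk_comparator_le:
  assumes "0 \<le> r"
  shows "n * R (v0 + r *\<^sub>R esc) \<le> L0 + n * exp (norm v0 - rate * r)"
proof -
  let ?z = "v0 + r *\<^sub>R esc"
  have "Loss l (As d A \<odot> ?z) = L0"
    unfolding Loss_matvec
    by (intro arg_cong[where f = sum_list] map_cong) (auto simp: inner_add_right inner_esc_As)
  moreover have "Loss l (Ac d A \<odot> ?z) \<le> (\<Sum>a\<leftarrow>Ac d A. exp (norm v0 - rate * r))"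
    unfolding Loss_matvec
  proof (rule sum_list_mono)
    fix a assume a: "a \<in> set (Ac d A)"
    have "inner a v0 \<le> norm v0" using inner_row_le[of a v0] a set_As_Ac by fastforce
    moreover have "r * inner a esc \<le> r * - rate"
      using inner_esc_Ac[OF a] assms by (rule mult_left_mono)
    ultimately have "inner a ?z \<le> norm v0 - rate * r" by (simp add: inner_add_right mult.commute)
    then show "l (inner a ?z) \<le> exp (norm v0 - rate * r)"
      using le_exp[of "inner a ?z"] exp_le_cancel_iff order_trans by blast
  qed
  moreover have "\<dots> \<le> n * exp (norm v0 - rate * r)"
    using length_As_Ac[of A d] by (simp add: sum_list_triv mult_right_mono)
  ultimately show ?thesis by (simp add: n_risk)
qed

text \<open>Either the projection lies in the sublevel set, or the risk of w_j exceeds that of a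
  comparison point whose r lets \<open>A_c\<close> contribute at most 1; then the whole iterate is
  at most twice as long as that point. The second case costs ln n and the division by
  \<open>rate\<close>.\<close>

lemma norm_proj_w_le:
  assumes \<rho>: "\<And>v. v \<in> S d A \<Longrightarrow> Loss l (As d A \<odot> v) \<le> L0 + 1 \<Longrightarrow> norm v \<le> \<rho>"
  shows "norm (\<pi> (w j)) \<le> (4 * \<rho> + 2 * ln n) / rate"
proof -
  have v0: "norm v0 \<le> \<rho>" using \<rho>[OF vbar_mem] by simp
  then have "0 \<le> \<rho>" using norm_ge_zero order_trans by blast
  note ln = ln_n_nonneg
  show ?thesis
  proof (cases "Loss l (As d A \<odot> \<pi> (w j)) \<le> L0 + 1")
    case True
    then have "norm (\<pi> (w j)) \<le> \<rho>" using \<rho> proj_S_mem by blast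
    also have "\<dots> \<le> (4 * \<rho> + 2 * ln n) / 1" using \<open>0 \<le> \<rho>\<close> ln by simp
    also have "\<dots> \<le> (4 * \<rho> + 2 * ln n) / rate"
      using \<open>0 \<le> \<rho>\<close> ln rate_pos rate_le by (intro divide_left_mono) auto
    finally show ?thesis .
  next
    case False
    define r where "r = (norm v0 + ln n) / rate"
    have r: "0 \<le> r" "rate * r = norm v0 + ln n" using rate_pos ln by (auto simp: r_def)
    have "n * R (v0 + r *\<^sub>R esc) \<le> L0 + n * exp (norm v0 - rate * r)"
      by (rule risk_comparator_le[OF r(1)])
    also have "n * exp (norm v0 - rate * r) = 1" using n_pos by (simp add: r(2) exp_minus)
    finally have "n * R (v0 + r *\<^sub>R esc) \<le> n * R (w j)"
      using False Loss_As_le_risk[of "w j"] by linarith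
    then have "R (v0 + r *\<^sub>R esc) \<le> R (w j)" using n_pos by simp
    then have "norm (w j) \<le> 2 * (norm v0 + r)"
      using norm_w_le_of_lower_risk norm_comparator_le[OF r(1)] by fastforce
    moreover have "norm v0 \<le> norm v0 / rate"
      using rate_pos rate_le by (simp add: le_divide_eq mult_left_le)
    moreover have "(4 * norm v0 + 2 * ln n) / rate \<le> (4 * \<rho> + 2 * ln n) / rate"
      using v0 rate_pos by (intro divide_right_mono) auto
    ultimately show ?thesis
      using norm_proj_S_le[of d A "w j"] by (simp add: r_def add_divide_distrib)
  qed
qed

lemma w_Rd: "w j \<in> Rd d"
  using w_in_span span_minimal[OF _ subspace_Rd, of "set A"] row_Rd by blast

section \<open>Progress along the margin direction and growth of the distance to S\<close>

context
  assumes Ac_nonempty: "Ac d A \<noteq> []"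
begin

definition mass :: "rvec \<Rightarrow> real" where
  "mass x = (\<Sum>a\<leftarrow>Ac d A. l' (inner a x)) / n"

lemma mass_pos: "0 \<le> mass x"
  unfolding mass_def using first_pos
  by (intro divide_nonneg_nonneg sum_list_nonneg) (auto intro: less_imp_le)

lemma inner_G_perp:
  assumes "\<And>s. s \<in> S d A \<Longrightarrow> inner s y = 0"
  shows "inner (G x) y = (\<Sum>a\<leftarrow>Ac d A. l' (inner a x) * inner a y) / n"
proof -
  have "(\<Sum>a\<leftarrow>As d A. l' (inner a x) * inner a y) = (\<Sum>a\<leftarrow>As d A. 0)"
    using assms As_in_S by (intro arg_cong[where f = sum_list] map_cong) auto
  then show ?thesis by (simp add: inner_risk_grad sum_list_As_Ac[of _ A d])
qed

lemma inner_G_ubar: "inner (G x) u \<le> - \<gamma> * mass x"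
proof -
  have "(\<Sum>a\<leftarrow>Ac d A. l' (inner a x) * inner a u) \<le> (\<Sum>a\<leftarrow>Ac d A. (- \<gamma>) * l' (inner a x))"
  proof (rule sum_list_mono)
    fix a assume "a \<in> set (Ac d A)"
    then have "l' (inner a x) * inner a u \<le> l' (inner a x) * - \<gamma>"
      using Ac_inner_ubar[OF Ac_nonempty] first_pos by (intro mult_left_mono) (auto intro: less_imp_le)
    then show "l' (inner a x) * inner a u \<le> - \<gamma> * l' (inner a x)" by (simp add: mult.commute)
  qed
  then have "(\<Sum>a\<leftarrow>Ac d A. l' (inner a x) * inner a u) / n \<le> (- \<gamma>) * (\<Sum>a\<leftarrow>Ac d A. l' (inner a x)) / n"
    unfolding sum_list_const_mult by (intro divide_right_mono) auto
  then show ?thesis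
    using inner_G_perp[OF inner_S_ubar[OF Ac_nonempty]] by (simp add: mass_def)
qed

lemma ubar_progress: "inner (w j) u + \<gamma> * \<eta> j * mass (w j) \<le> inner (w (Suc j)) u"
  using mult_left_mono[OF inner_G_ubar[of "w j"] less_imp_le[OF step_pos[of j]]]
  by (simp add: w_Suc inner_diff_left algebra_simps)

lemma ubar_mono: "i \<le> j \<Longrightarrow> inner (w i) u \<le> inner (w j) u"
proof (rule lift_Suc_mono_le)
  fix j
  have "0 \<le> \<gamma> * \<eta> j * mass (w j)"
    using margin_pos[OF Ac_nonempty] step_pos[of j] mass_pos[of "w j"] by simp
  with ubar_progress[of j] show "inner (w j) u \<le> inner (w (Suc j)) u" by linarith
qed

lemma inner_w_ubar_nonneg: "0 \<le> inner (w j) u"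
  using ubar_mono[of 0 j] by simp

lemma inner_ubar_le_norm: "inner x u \<le> norm x"
  using norm_cauchy_schwarz[of x u] norm_ubar[OF Ac_nonempty] by simp

lemma ubar_progress_sum:
  assumes "\<And>j. j < t \<Longrightarrow> c \<le> mass (w j)"
  shows "\<gamma> * (\<Sum>j<t. \<eta> j) * c \<le> inner (w t) u"
  using assms
proof (induction t)
  case (Suc t)
  have "\<gamma> * \<eta> t * c \<le> \<gamma> * \<eta> t * mass (w t)"
    using margin_pos[OF Ac_nonempty] step_pos[of t] Suc.prems by (intro mult_left_mono) auto
  with Suc.IH Suc.prems ubar_progress[of t] show ?case by (simp add: algebra_simps)
qed simp

text \<open>The iterates up to time \<open>t\<close> have norm at most \<open>2 |w_t|\<close>, so none of the rows of \<open>A_c\<close> was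
  fitted better than that.\<close>

lemma growth:
  "\<gamma> * (\<Sum>j<t. \<eta> j) * (length (Ac d A) / n / (1 + exp (2 * norm (w t)))) \<le> inner (w t) u"
proof (rule ubar_progress_sum)
  fix j assume j: "j < t"
  have "1 / (1 + exp (2 * norm (w t))) \<le> l' (inner a (w j))" if "a \<in> set (Ac d A)" for a
  proof -
    have "\<bar>inner a (w j)\<bar> \<le> norm (w j)" using that set_As_Ac by (intro inner_row_le) blast
    then have "- (2 * norm (w t)) \<le> inner a (w j)" using norm_w_le_twice[of j t] j by linarith
    from first_mono[OF this] sigmoid_le[of "- (2 * norm (w t))"] show ?thesis by simp
  qed
  then have "(\<Sum>a\<leftarrow>Ac d A. 1 / (1 + exp (2 * norm (w t)))) / n \<le> mass (w j)"
    unfolding mass_def by (intro divide_right_mono sum_list_mono) auto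
  then show "length (Ac d A) / n / (1 + exp (2 * norm (w t))) \<le> mass (w j)"
    by (simp add: sum_list_triv mult.commute)
qed

text \<open>Without S the margin bound on the worst row gives the exponent
  \<open>inner (w t) u\<close> in place of 2 |w_t|, at the price of counting a single row. The
  threshold 21/20 at small t depends on this sharper exponent.\<close>

lemma growth_separable:
  assumes "S d A = {0}"
  shows "\<gamma> * (\<Sum>j<t. \<eta> j) * (1 / n / (1 + exp (inner (w t) u))) \<le> inner (w t) u"
proof (rule ubar_progress_sum)
  fix j assume j: "j < t"
  obtain a where a: "a \<in> set (Ac d A)" "- \<gamma> * inner (w j) u - norm (\<pi> (w j)) \<le> inner a (w j)"
    using exists_Ac_row_ge[OF Ac_nonempty] by blast
  have "\<pi> (w j) = 0" using proj_S_mem[of d A "w j"] assms by simp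
  moreover have "\<gamma> * inner (w j) u \<le> 1 * inner (w t) u"
    using margin_pos[OF Ac_nonempty] margin_le[OF Ac_nonempty] ubar_mono[of j t] j inner_w_ubar_nonneg
    by (intro mult_mono) auto
  ultimately have "- inner (w t) u \<le> inner a (w j)" using a(2) by simp
  then have "1 / (1 + exp (inner (w t) u)) \<le> l' (inner a (w j))"
    using first_mono[of "- inner (w t) u" "inner a (w j)"] sigmoid_le[of "- inner (w t) u"] by simp
  also have "\<dots> \<le> (\<Sum>a\<leftarrow>Ac d A. l' (inner a (w j)))"
    using a(1) first_pos by (intro member_le_sum_list) (auto intro: less_imp_le)
  finally have "1 / (1 + exp (inner (w t) u)) / n \<le> mass (w j)"
    unfolding mass_def by (rule divide_right_mono) simp
  then show "1 / n / (1 + exp (inner (w t) u)) \<le> mass (w j)" by (simp add: mult.commute)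
qed

text \<open>This is \<open>weighted_entries_le\<close> applied to the row from
  \<open>exists_Ac_row_ge\<close>; passing from x to its residual adds |\<pi> x| a second
  time.\<close>

lemma residual_ascent_le:
  assumes "0 \<le> inner x u"
  shows "- inner (G x) (x - \<pi> x) \<le> mass x * (\<gamma> * inner x u + 2 * norm (\<pi> x) + 2 * ln n + 2)"
proof -
  let ?N = "\<gamma> * inner x u + norm (\<pi> x)"
  let ?zs = "map (\<lambda>a. inner a x) (Ac d A)"
  obtain a where a: "a \<in> set (Ac d A)" "- ?N \<le> inner a x"
    using exists_Ac_row_ge[OF Ac_nonempty, of x] by auto
  have "0 \<le> ?N" using assms margin_pos[OF Ac_nonempty] by simp
  moreover have "length ?zs \<le> n" using length_As_Ac[of A d] by simp
  moreover have "inner a x \<in> set ?zs" using a(1) by simp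
  ultimately have "(\<Sum>z\<leftarrow>?zs. l' z * (- z)) \<le> (?N + 2 * ln n + 2) * (\<Sum>z\<leftarrow>?zs. l' z)"
    using a(2) by (intro weighted_entries_le)
  then have le: "(\<Sum>a\<leftarrow>Ac d A. l' (inner a x) * - inner a x)
      \<le> (?N + 2 * ln n + 2) * (\<Sum>a\<leftarrow>Ac d A. l' (inner a x))"
    by (simp add: comp_def)
  have "(\<Sum>a\<leftarrow>Ac d A. l' (inner a x) * - inner a (x - \<pi> x))
      \<le> (\<Sum>a\<leftarrow>Ac d A. l' (inner a x) * - inner a x + norm (\<pi> x) * l' (inner a x))"
  proof (rule sum_list_mono)
    fix a assume "a \<in> set (Ac d A)"
    then have "\<bar>inner a (\<pi> x)\<bar> \<le> norm (\<pi> x)" using set_As_Ac by (intro inner_row_le) blast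
    then have "l' (inner a x) * inner a (\<pi> x) \<le> l' (inner a x) * norm (\<pi> x)"
      using first_pos[of "inner a x"] by (intro mult_left_mono) auto
    then show "l' (inner a x) * - inner a (x - \<pi> x)
        \<le> l' (inner a x) * - inner a x + norm (\<pi> x) * l' (inner a x)"
      by (simp add: inner_diff_right algebra_simps)
  qed
  also have "\<dots> \<le> (?N + 2 * ln n + 2 + norm (\<pi> x)) * (\<Sum>a\<leftarrow>Ac d A. l' (inner a x))"
    using le unfolding sum_list_addf sum_list_const_mult
    by (subst distrib_right[of _ "norm (\<pi> x)"]) (rule add_right_mono)
  finally have "(\<Sum>a\<leftarrow>Ac d A. l' (inner a x) * - inner a (x - \<pi> x)) / n
      \<le> (?N + 2 * ln n + 2 + norm (\<pi> x)) * (\<Sum>a\<leftarrow>Ac d A. l' (inner a x)) / n"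
    by (rule divide_right_mono) simp
  moreover have "(\<Sum>a\<leftarrow>Ac d A. l' (inner a x) * - inner a (x - \<pi> x)) / n = - inner (G x) (x - \<pi> x)"
  proof (subst inner_G_perp)
    fix s assume "s \<in> S d A"
    then show "inner s (x - \<pi> x) = 0" using proj_S_inner[of s d A x] by (simp add: inner_commute)
  qed (simp add: minus_divide_left uminus_sum_list_map comp_def del: divide_minus_left)
  ultimately have "- inner (G x) (x - \<pi> x) \<le> (?N + 2 * ln n + 2 + norm (\<pi> x)) * mass x"
    by (simp only: mass_def times_divide_eq_right)
  then show ?thesis by (simp add: algebra_simps)
qed

text \<open>A perceptron-type argument: the squared distance of \<open>w_j\<close> to \<open>S\<close> grows essentially as fast
  as the square of its component along \<open>u\<close>.\<close>

lemma residual_le: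
  assumes "\<And>j. j < t \<Longrightarrow> norm (\<pi> (w j)) \<le> P" "0 \<le> P"
  shows "(norm (w t - \<pi> (w t)))\<^sup>2
    \<le> (inner (w t) u)\<^sup>2 + 2 * ((2 * P + 2 * ln n + 2) / \<gamma>) * inner (w t) u + 2"
proof -
  define K where "K = (2 * P + 2 * ln n + 2) / \<gamma>"
  have \<gamma>: "0 < \<gamma>" by (rule margin_pos[OF Ac_nonempty])
  have K: "0 \<le> K" "\<gamma> * K = 2 * P + 2 * ln n + 2" using assms(2) ln_n_nonneg \<gamma> by (auto simp: K_def)
  have "(norm (w t - \<pi> (w t)))\<^sup>2
    \<le> (inner (w t) u)\<^sup>2 + 2 * K * inner (w t) u + (\<Sum>j<t. (norm (w (Suc j) - w j))\<^sup>2)"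
    using assms(1)
  proof (induction t)
    case 0
    show ?case using norm_proj_S_le[of d A 0] by simp
  next
    case (Suc t)
    let ?s = "inner (w t) u" and ?s' = "inner (w (Suc t)) u" and ?q = "w t - \<pi> (w t)"
    have IH: "(norm ?q)\<^sup>2 \<le> ?s\<^sup>2 + 2 * K * ?s + (\<Sum>j<t. (norm (w (Suc j) - w j))\<^sup>2)"
      using Suc by auto
    have s: "0 \<le> ?s" "?s \<le> ?s'" using inner_w_ubar_nonneg ubar_mono by auto
    \<comment> \<open>The distance to S after the step is at most the distance to the old
      projection.\<close>
    have "(norm (w (Suc t) - \<pi> (w (Suc t))))\<^sup>2 \<le> (norm (?q + (w (Suc t) - w t)))\<^sup>2"
      using dist_proj_S_le[OF proj_S_mem, of "w (Suc t)" d A "w t"] by (intro power_mono) auto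
    also have "\<dots> = (norm ?q)\<^sup>2 + 2 * inner ?q (w (Suc t) - w t) + (norm (w (Suc t) - w t))\<^sup>2"
      by (simp only: power2_norm_eq_inner inner_add_left inner_add_right inner_commute)
    also have "inner ?q (w (Suc t) - w t) = \<eta> t * - inner (G (w t)) ?q"
      by (simp add: w_Suc inner_commute)
    also have "\<dots> \<le> \<eta> t * (mass (w t) * (\<gamma> * ?s + \<gamma> * K))"
    proof (rule mult_left_mono)
      have "mass (w t) * (\<gamma> * ?s + 2 * norm (\<pi> (w t)) + 2 * ln n + 2) \<le> mass (w t) * (\<gamma> * ?s + \<gamma> * K)"
        using Suc.prems[of t] mass_pos by (intro mult_left_mono) (auto simp: K(2))
      with residual_ascent_le[OF s(1)]
      show "- inner (G (w t)) ?q \<le> mass (w t) * (\<gamma> * ?s + \<gamma> * K)" by linarith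
    qed (use step_pos[of t] in simp)
    also have "\<dots> = (\<gamma> * \<eta> t * mass (w t)) * (?s + K)" by (simp add: algebra_simps)
    \<comment> \<open>The product of \<gamma>, step size and mass is at most the progress along u,
      so the gradient disappears from the bound. What remains is a Riemann sum of s + K over the
      increments of s.\<close>
    also have "\<dots> \<le> (?s' - ?s) * (?s + K)"
      using ubar_progress[of t] s K by (intro mult_right_mono) auto
    also have "2 * ((?s' - ?s) * (?s + K)) \<le> ?s'\<^sup>2 - ?s\<^sup>2 + 2 * K * (?s' - ?s)"
      using zero_le_power2[of "?s' - ?s"] by (simp add: power2_eq_square algebra_simps)
    finally show ?case using IH by (simp add: algebra_simps)
  qed
  with sum_step_square_le[of t] show ?thesis unfolding K_def by linarith
qed

end
end

section \<open>Excess risk, norms and directional errors with explicit constants\<close>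

context data_descent
begin

lemma norm_vbar_le_radius:
  assumes \<rho>: "\<And>v. v \<in> S d A \<Longrightarrow> Loss l (As d A \<odot> v) \<le> L0 + 1 \<Longrightarrow> norm v \<le> \<rho>"
  shows "norm v0 \<le> \<rho>"
  using \<rho>[OF vbar_mem] by simp

text \<open>A larger r fits \<open>A_c\<close> better but is paid for by the squared distance from
  the start; r will be ln t / \<open>rate\<close>.\<close>

lemma excess_risk_le:
  assumes "0 \<le> r" "0 < T" "T \<le> (\<Sum>j<t. \<eta> j)"
  shows "n * R (w t) - L0 \<le> n * exp (norm v0 - rate * r) + n * (norm v0 + r)\<^sup>2 / (2 * T)"
proof (cases "R (v0 + r *\<^sub>R esc) \<le> R (w t)")
  case True
  let ?z = "v0 + r *\<^sub>R esc"
  have "0 \<le> (norm ?z)\<^sup>2 + 2 * (\<Sum>j<t. \<eta> j) * (R ?z - R (w t))"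
    using dist_le[of t ?z] zero_le_power2 order_trans by blast
  moreover have "T * (R (w t) - R ?z) \<le> (\<Sum>j<t. \<eta> j) * (R (w t) - R ?z)"
    using True assms(3) by (intro mult_right_mono) auto
  moreover have "(norm ?z)\<^sup>2 \<le> (norm v0 + r)\<^sup>2"
    using norm_comparator_le[OF assms(1)] by (intro power_mono) auto
  ultimately have "(R (w t) - R ?z) * (2 * T) \<le> (norm v0 + r)\<^sup>2" by (simp add: algebra_simps)
  then have "R (w t) - R ?z \<le> (norm v0 + r)\<^sup>2 / (2 * T)"
    using assms(2) by (simp add: pos_le_divide_eq)
  then have "n * (R (w t) - R ?z) \<le> n * ((norm v0 + r)\<^sup>2 / (2 * T))" by (rule mult_left_mono) simp
  with risk_comparator_le[OF assms(1)] show ?thesis by (simp add: algebra_simps)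
next
  case False
  then have "n * R (w t) \<le> n * R (v0 + r *\<^sub>R esc)" by (intro mult_left_mono) auto
  moreover have "0 \<le> n * (norm v0 + r)\<^sup>2 / (2 * T)" using assms(2) by simp
  ultimately show ?thesis using risk_comparator_le[OF assms(1)] by linarith
qed

text \<open>For r = ln t / \<open>rate\<close> the risk of the comparison point exceeds that of w_t
  by at most \<open>exp (norm v0) / t\<close>. As the step sizes add up to at most t, the squared
  distance to this point grows by a bounded amount only.\<close>

lemma norm_w_le:
  assumes "1 \<le> t"
  shows "norm (w t) \<le> 2 * (norm v0 + ln t / rate) + 2 * exp (norm v0)"
proof -
  define r where "r = ln (real t) / rate"
  have r: "0 \<le> r" "rate * r = ln t" using assms rate_pos by (auto simp: r_def)
  let ?z = "v0 + r *\<^sub>R esc" and ?E = "exp (norm v0)"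
  have "n * R ?z \<le> L0 + n * exp (norm v0 - ln t)" using risk_comparator_le[OF r(1)] by (simp only: r(2))
  moreover have "exp (norm v0 - ln t) = ?E / t" using assms by (simp add: exp_diff)
  moreover have "L0 \<le> n * R (w t)"
    using Loss_Ac_le_risk[of "w t"] Loss_nonneg[of "Ac d A" "w t"] by linarith
  ultimately have "n * (R ?z - R (w t)) \<le> n * (?E / t)" by (simp add: right_diff_distrib)
  then have gap: "R ?z - R (w t) \<le> ?E / t" by (rule mult_left_le_imp_le) (use n_pos in simp)
  define T where "T = (\<Sum>j<t. \<eta> j)"
  have T: "0 \<le> T" "T \<le> t"
    using sum_mono[of "{..<t}" \<eta> "\<lambda>_. 1"] step_le step_pos
    by (auto simp: T_def intro: sum_nonneg less_imp_le)
  have "T * (R ?z - R (w t)) \<le> T * (?E / t)" using gap T by (intro mult_left_mono)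
  also have "\<dots> \<le> t * (?E / t)" using T by (intro mult_right_mono) auto
  also have "\<dots> = ?E" using assms by simp
  finally have "(norm (w t - ?z))\<^sup>2 \<le> (norm ?z)\<^sup>2 + 2 * ?E"
    using dist_le[of t ?z] by (simp add: T_def)
  also have "\<dots> \<le> (norm ?z + 2 * ?E)\<^sup>2"
  proof -
    have "1 * ?E \<le> ?E * ?E" by (intro mult_right_mono) auto
    moreover have "0 \<le> norm ?z * ?E" by simp
    ultimately have "2 * ?E \<le> 4 * (norm ?z * ?E) + 4 * (?E * ?E)" using exp_ge_zero[of "norm v0"] by linarith
    then show ?thesis by (simp add: power2_eq_square algebra_simps)
  qed
  finally have "norm (w t - ?z) \<le> norm ?z + 2 * ?E" by (rule power2_le_imp_le) (simp add: add_nonneg_nonneg)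
  then have "norm (w t) \<le> 2 * norm ?z + 2 * ?E" using norm_triangle_sub[of "w t" ?z] by linarith
  with norm_comparator_le[OF r(1)] show ?thesis by (simp add: r_def)
qed

context
  assumes Ac_nonempty: "Ac d A \<noteq> []"
begin

lemma rate_eq: "rate = \<gamma>"
  using Ac_nonempty by (simp add: rate_def)

text \<open>The error times |w_t| equals 2 (N - s), and \<open>residual_le\<close> bounds (N - s)(N
  + s) by a multiple of N + s. P is of order 1/\<gamma> and K of order 1/\<gamma>^2, hence the
  factor \<gamma>^2.\<close>

lemma dir_error_w_le:
  assumes \<rho>: "\<And>v. v \<in> S d A \<Longrightarrow> Loss l (As d A \<odot> v) \<le> L0 + 1 \<Longrightarrow> norm v \<le> \<rho>"
    and "1 \<le> norm (w t)"
  shows "dir_error d A (w t) * norm (w t) * \<gamma>\<^sup>2 \<le> (40 * \<rho> + 28) * (1 + ln n)"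
proof -
  define N where "N = norm (w t)"
  define s where "s = inner (w t) u"
  define P where "P = (4 * \<rho> + 2 * ln n) / \<gamma>"
  define K where "K = (2 * P + 2 * ln n + 2) / \<gamma>"
  note \<gamma> = margin_pos[OF Ac_nonempty] margin_le[OF Ac_nonempty]
  have "0 \<le> \<rho>" using norm_vbar_le_radius[OF \<rho>] norm_ge_zero order_trans by blast
  then have X: "0 \<le> 4 * \<rho> + 2 * ln n" using ln_n_nonneg by simp
  have P: "0 \<le> P" "\<gamma> * P = 4 * \<rho> + 2 * ln n" using X \<gamma> by (simp_all add: P_def)
  have K: "0 \<le> K" "\<gamma> * K = 2 * P + 2 * ln n + 2" using P \<gamma> ln_n_nonneg by (simp_all add: K_def)
  have proj: "norm (\<pi> (w j)) \<le> P" for j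
    using norm_proj_w_le[OF \<rho>] by (simp add: P_def rate_eq)
  have N: "1 \<le> N" "0 \<le> s" "s \<le> N" "norm (\<pi> (w t)) \<le> N"
    using assms(2) inner_w_ubar_nonneg[OF Ac_nonempty] inner_ubar_le_norm[OF Ac_nonempty] norm_proj_S_le
    by (auto simp: N_def s_def)
  have "N\<^sup>2 \<le> (norm (\<pi> (w t)))\<^sup>2 + s\<^sup>2 + 2 * K * s + 2"
    using norm_proj_S_pythagoras[of "w t" d A] residual_le[OF Ac_nonempty proj P(1), of t]
    unfolding N_def s_def K_def by linarith
  \<comment> \<open>Bounding one factor by P and the other by N allows N + s to be
    cancelled.\<close>
  moreover have "(norm (\<pi> (w t)))\<^sup>2 \<le> P * (N + s)"
    unfolding power2_eq_square using proj[of t] N P by (intro mult_mono) auto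
  moreover have "K * s \<le> K * (N + s)" using K N by (intro mult_left_mono) auto
  ultimately have "(N - s) * (N + s) \<le> (P + 2 * K + 2) * (N + s)"
    using N by (simp add: power2_eq_square algebra_simps)
  then have "N - s \<le> P + 2 * K + 2" by (rule mult_right_le_imp_le) (use N in simp)
  then have "\<gamma>\<^sup>2 * (N - s) \<le> \<gamma>\<^sup>2 * (P + 2 * K + 2)" by (rule mult_left_mono) simp
  also have "\<dots> = \<gamma> * (\<gamma> * P) + 2 * (\<gamma> * (\<gamma> * K)) + 2 * \<gamma>\<^sup>2" by (simp add: power2_eq_square algebra_simps)
  also have "\<dots> = \<gamma> * (4 * \<rho> + 2 * ln n) + 4 * (4 * \<rho> + 2 * ln n) + \<gamma> * (4 * ln n + 4) + 2 * \<gamma>\<^sup>2"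
  proof -
    have "\<gamma> * (\<gamma> * K) = 2 * (\<gamma> * P) + \<gamma> * (2 * ln n + 2)" unfolding K(2) by (simp add: algebra_simps)
    then show ?thesis unfolding P(2) by (simp add: algebra_simps)
  qed
  also have "\<dots> \<le> 1 * (4 * \<rho> + 2 * ln n) + 4 * (4 * \<rho> + 2 * ln n) + 1 * (4 * ln n + 4) + 2 * 1"
    using \<gamma> X ln_n_nonneg power_le_one[of \<gamma> 2] by (intro add_mono mult_left_mono mult_right_mono) auto
  finally have "2 * (N - s) * \<gamma>\<^sup>2 \<le> 40 * \<rho> + 28 * ln n + 12" by (simp add: algebra_simps)
  moreover have "w t \<noteq> 0" using N by (auto simp: N_def)
  then have "dir_error d A (w t) * N = 2 * (N - s)"
    using dir_error_eq[OF norm_ubar[OF Ac_nonempty], of "w t"] by (simp add: N_def s_def field_simps)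
  moreover have "(40 * \<rho> + 28) * (1 + ln n) = 40 * \<rho> + 28 + 28 * ln n + 40 * (\<rho> * ln n)"
    by (simp add: algebra_simps)
  moreover have "0 \<le> \<rho> * ln n" using \<open>0 \<le> \<rho>\<close> ln_n_nonneg by simp
  ultimately show ?thesis unfolding N_def[symmetric] by simp
qed

text \<open>A ball too small for the comparison point to fit all of \<open>A_c\<close> makes the bound trivial.\<close>

lemma dir_error_ball_minimizer_le:
  assumes \<rho>: "\<And>v. v \<in> S d A \<Longrightarrow> Loss l (As d A \<odot> v) \<le> L0 + 1 \<Longrightarrow> norm v \<le> \<rho>"
    and b: "ball_minimizer l d A x b" and x: "0 < norm x"
  shows "dir_error d A b * norm x * \<gamma>\<^sup>2 \<le> (40 * \<rho> + 28) * (1 + ln n)"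
proof -
  define N where "N = norm x"
  define s where "s = inner b u"
  note \<gamma> = margin_pos[OF Ac_nonempty] margin_le[OF Ac_nonempty]
  have v0: "norm v0 \<le> \<rho>" by (rule norm_vbar_le_radius[OF \<rho>])
  then have "0 \<le> \<rho>" using norm_ge_zero order_trans by blast
  have b: "norm b \<le> N" "\<And>z. z \<in> Rd d \<Longrightarrow> norm z \<le> N \<Longrightarrow> R b \<le> R z"
    using b by (auto simp: ball_minimizer_def is_arg_min_def not_less N_def)
  \<comment> \<open>If \<gamma> N is at most E, the trivial bound 4 on the error suffices. Otherwise
    \<open>\<xi> \<le> 1\<close>, and E also covers the loss ln 2 + ln n + 3 \<rho> in the margin
    estimate.\<close>
  define E where "E = 1 + ln n + 3 * \<rho>"
  have "0 \<le> E" using \<open>0 \<le> \<rho>\<close> ln_n_nonneg by (simp add: E_def)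
  have E_le: "4 * E \<le> (40 * \<rho> + 28) * (1 + ln n)"
  proof -
    have "0 \<le> \<rho> * ln n" using \<open>0 \<le> \<rho>\<close> ln_n_nonneg by simp
    then show ?thesis using \<open>0 \<le> \<rho>\<close> ln_n_nonneg by (simp add: E_def algebra_simps)
  qed
  have "dir_error d A b * N * \<gamma> \<le> 4 * E"
  proof (cases "\<gamma> * N \<le> E")
    case True
    have "dir_error d A b * (N * \<gamma>) \<le> 4 * (N * \<gamma>)"
      using dir_error_le_4[OF norm_ubar[OF Ac_nonempty]] \<gamma> by (intro mult_right_mono) (auto simp: N_def)
    with True show ?thesis by (simp add: mult_ac)
  next
    case False
    define \<xi> where "\<xi> = n * exp (2 * norm v0 - \<gamma> * N)"
    \<comment> \<open>The norm bound on the comparison point then just reaches the radius of the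
      ball.\<close>
    define r where "r = N - norm v0"
    have "\<gamma> * N \<le> 1 * N" using \<gamma> by (intro mult_right_mono) (auto simp: N_def)
    then have r: "0 \<le> r" using False v0 \<open>0 \<le> \<rho>\<close> ln_n_nonneg by (simp add: r_def E_def)
    have "\<xi> \<le> n * exp (- ln n)"
      unfolding \<xi>_def using False v0 \<open>0 \<le> \<rho>\<close> by (intro mult_left_mono) (auto simp: E_def)
    also have "\<dots> = 1" using n_pos by (simp add: exp_minus)
    finally have \<xi>: "\<xi> \<le> 1" .
    have "norm (v0 + r *\<^sub>R esc) \<le> N" using norm_comparator_le[OF r] by (simp add: r_def)
    then have "n * R b \<le> n * R (v0 + r *\<^sub>R esc)"
      by (intro mult_left_mono b(2) comparator_Rd) auto
    also have "\<dots> \<le> L0 + n * exp (norm v0 - \<gamma> * r)"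
      using risk_comparator_le[OF r] by (simp add: rate_eq)
    also have "norm v0 - \<gamma> * r \<le> 2 * norm v0 - \<gamma> * N"
      using mult_right_mono[OF \<gamma>(2), of "norm v0"] by (simp add: r_def algebra_simps)
    finally have risk: "n * R b \<le> L0 + \<xi>" by (simp add: \<xi>_def mult_left_mono)
    then have "Loss l (As d A \<odot> \<pi> b) \<le> L0 + 1" using Loss_As_le_risk[of b] \<xi> by linarith
    then have proj: "norm (\<pi> b) \<le> \<rho>" using \<rho> proj_S_mem by blast
    obtain a where a: "a \<in> set (Ac d A)" "- \<gamma> * s - norm (\<pi> b) \<le> inner a b"
      using exists_Ac_row_ge[OF Ac_nonempty, of b] by (auto simp: s_def)
    have "l (inner a b) \<le> Loss l (Ac d A \<odot> b)"
      unfolding Loss_matvec using a(1) loss_pos by (intro member_le_sum_list) (auto intro: less_imp_le)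
    then have "l (inner a b) \<le> \<xi>" using Loss_Ac_le_risk[of b] risk by linarith
    then have "exp (inner a b) \<le> 2 * \<xi>" using \<xi> by (rule exp_le_twice)
    also have "\<dots> = exp (ln 2 + ln n + (2 * norm v0 - \<gamma> * N))"
      using n_pos by (simp only: \<xi>_def exp_add) simp
    finally have "inner a b \<le> ln 2 + ln n + (2 * norm v0 - \<gamma> * N)" by simp
    then have s: "\<gamma> * N - E \<le> \<gamma> * s"
      using a(2) proj v0 ln_2_less_1 unfolding E_def by linarith
    then have "0 < \<gamma> * s" using False by linarith
    then have "0 < s" using \<gamma> by (simp add: zero_less_mult_iff)
    then have "b \<noteq> 0" by (auto simp: s_def)
    \<comment> \<open>The error is measured against |x|, but b may be shorter; as s is positive,
      this only improves the angle.\<close>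
    have "s / N \<le> s / norm b"
      using \<open>0 < s\<close> \<open>b \<noteq> 0\<close> b(1) x by (intro divide_left_mono) (auto simp: N_def)
    then have "dir_error d A b \<le> 2 - 2 * (s / N)"
      using dir_error_eq[OF norm_ubar[OF Ac_nonempty] \<open>b \<noteq> 0\<close>] by (simp add: s_def)
    then have "dir_error d A b * (N * \<gamma>) \<le> (2 - 2 * (s / N)) * (N * \<gamma>)"
      using x \<gamma> by (intro mult_right_mono) (auto simp: N_def)
    also have "\<dots> = 2 * (\<gamma> * N - \<gamma> * s)" using x by (simp add: N_def field_simps)
    finally show ?thesis using s \<open>0 \<le> E\<close> by (simp add: mult_ac)
  qed
  moreover have "dir_error d A b * N * \<gamma> * \<gamma> \<le> dir_error d A b * N * \<gamma> * 1"
    using \<gamma> by (intro mult_left_mono) (auto simp: N_def dir_error_def)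
  ultimately show ?thesis using E_le by (simp add: N_def power2_eq_square mult.assoc)
qed

end
end

section \<open>Rates in terms of the number of steps\<close>


text \<open>The cube 4.096 of 8/5 just exceeds 21/20 * (1 + 287/100), which yields the threshold
  21/20 in the separable case. The bound rests on e^8 \<le> 5^5.\<close>

lemma ln_ge_8_5:
  assumes "5 \<le> t"
  shows "8 / 5 \<le> ln (real t)"
proof -
  have "exp (8 / 5 :: real) ^ 5 = exp 1 ^ 8" by (simp flip: exp_of_nat_mult)
  also have "\<dots> \<le> (272 / 100) ^ 8" using e_less_272 by (intro power_mono) auto
  also have "\<dots> \<le> (5 :: real) ^ 5" by (simp add: divide_simps)
  finally have "exp (8 / 5 :: real) \<le> 5" by (subst (asm) power_mono_iff) auto
  also have "\<dots> \<le> real t" using assms by simp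
  finally show ?thesis using assms by (subst ln_ge_iff) auto
qed

lemma exp_21_20_le: "exp (21 / 20 :: real) \<le> 287 / 100"
proof -
  have "exp (21 / 20 :: real) = exp 1 * exp (1 / 20)" by (simp flip: exp_add)
  also have "\<dots> \<le> (272 / 100) * (1 + 1 / 20 + (1 / 20)\<^sup>2)"
    using e_less_272 exp_bound[of "1 / 20"] by (intro mult_mono) auto
  also have "\<dots> \<le> 287 / 100" by (simp add: power2_eq_square)
  finally show ?thesis .
qed

lemma ln_le_of_exponential_growth:
  fixes \<kappa> N :: real
  assumes "0 < \<kappa>" "\<kappa> \<le> N * (1 + exp (2 * N))" "1 \<le> N"
  shows "ln \<kappa> \<le> 4 * N"
proof -
  have N: "N \<le> exp N" "2 \<le> exp N" using exp_ge_add_one_self[of N] assms(3) by linarith+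
  have "1 \<le> exp (2 * N)" using assms(3) by simp
  then have "1 + exp (2 * N) \<le> exp (2 * N) * 2" by simp
  also have "\<dots> \<le> exp (2 * N) * exp N" using N by (intro mult_left_mono) auto
  finally have "N * (1 + exp (2 * N)) \<le> exp N * (exp (2 * N) * exp N)"
    using N assms(3) by (intro mult_mono) auto
  also have "\<dots> = exp (4 * N)" by (simp flip: exp_add)
  finally have "\<kappa> \<le> exp (4 * N)" using assms(2) by linarith
  then show ?thesis using assms(1) by (metis ln_exp ln_le_cancel_iff exp_gt_zero)
qed

text \<open>The quotient need not be monotone for small arguments, hence two cases. Up to y the
  numerators are compared directly. Beyond y, \<open>ln (x / y) \<le> x / y - 1\<close> leaves an
  extra \<open>1 / y\<close>, absorbed by \<open>1 \<le> 3 * ln y\<close>; so 4 = 1 + 3.\<close>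

lemma ln_quotient_compare:
  fixes L x y c :: real
  assumes "0 \<le> L" "1 \<le> x" "8 / 5 \<le> y" "0 < c" "c * y \<le> x"
  shows "(L + ln x) / x \<le> (4 + 1 / c) * ((L + ln y) / y)"
proof -
  have lny: "3 / 8 \<le> ln y"
  proof -
    have "ln (inverse y) \<le> inverse y - 1" using assms(3) by (intro ln_le_minus_one) simp
    moreover have "inverse y \<le> inverse (8 / 5)" using assms(3) by (intro le_imp_inverse_le) auto
    ultimately show ?thesis using assms(3) by (simp add: ln_inverse)
  qed
  have inv: "1 / x \<le> 1 / c * (1 / y)"
    using assms by (simp add: field_simps)
  have "L * (1 / x) \<le> L * (1 / c * (1 / y))" using inv assms(1) by (rule mult_left_mono)
  moreover have "0 \<le> 4 * (L / y)" using assms by simp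
  ultimately have L: "L / x \<le> (4 + 1 / c) * (L / y)" by (simp add: distrib_right add_divide_distrib)
  have "ln x / x \<le> (4 + 1 / c) * (ln y / y)"
  proof (cases "x \<le> y")
    case True
    then have "ln x * (1 / x) \<le> ln y * (1 / c * (1 / y))"
      using inv assms lny by (intro mult_mono) auto
    moreover have "0 \<le> 4 * (ln y / y)" using assms lny by simp
    ultimately show ?thesis by (simp add: distrib_right add_divide_distrib)
  next
    case False
    have "ln x = ln y + ln (x / y)" using assms by (simp add: ln_div)
    also have "ln (x / y) \<le> x / y - 1" using assms by (intro ln_le_minus_one) auto
    finally have "ln x / x \<le> (ln y + x / y) / x" using assms by (intro divide_right_mono) auto
    also have "\<dots> = ln y / x + 1 / y" using assms by (simp add: add_divide_distrib)
    also have "ln y / x \<le> ln y / y" using False assms lny by (intro divide_left_mono) auto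
    also have "1 / y \<le> 3 * ln y / y" using lny assms by (intro divide_right_mono) auto
    finally have "ln x / x \<le> 4 * (ln y / y)" by simp
    moreover have "0 \<le> 1 / c * (ln y / y)" using assms lny by (intro mult_nonneg_nonneg) auto
    ultimately show ?thesis by (simp only: distrib_right)
  qed
  with L show ?thesis by (simp add: add_divide_distrib distrib_left)
qed

text \<open>From |x| \<ge> 21/20 follows ln |x| \<ge> 1/21, so 1 + ln n is at most 21 times the
  numerator of \<open>dir_rate\<close>. The second estimate is \<open>ln_quotient_compare\<close>
  with y = ln t.\<close>

lemma (in data) dir_rate_bounds:
  assumes "Ac d A \<noteq> []" "0 \<le> M" "0 < c" "5 \<le> t"
    and N: "21 / 20 \<le> norm x" "c * ln t \<le> norm x"
    and D: "D * norm x * \<gamma>\<^sup>2 \<le> M * (1 + ln (length A))"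
    and D': "D' * norm x * \<gamma>\<^sup>2 \<le> M * (1 + ln (length A))"
    and C: "21 * M \<le> C" "4 + 1 / c \<le> C"
  shows "max D D' \<le> C * dir_rate d A x \<and> dir_rate d A x \<le> C * dir_rate_t d A t"
proof -
  let ?N = "norm x" and ?L = "ln (real (length A))"
  have "1 \<le> length A" using rows_nonempty by (simp add: Suc_le_eq)
  then have L: "0 \<le> ?L" by simp
  have N0: "0 < ?N" using N by linarith
  then have "ln (inverse ?N) \<le> inverse ?N - 1" by (intro ln_le_minus_one) simp
  moreover have "inverse ?N \<le> inverse (21 / 20)" using N by (intro le_imp_inverse_le) auto
  ultimately have "1 / 21 \<le> ln ?N" using N0 by (simp add: ln_inverse)
  then have "1 + ?L \<le> 21 * (?L + ln ?N)" using L by simp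
  then have *: "M * (1 + ?L) \<le> M * (21 * (?L + ln ?N))" using assms(2) by (rule mult_left_mono)
  have \<gamma>: "0 < \<gamma>" by (rule margin_pos[OF assms(1)])
  have pos: "0 < ?N * \<gamma>\<^sup>2" using N0 \<gamma> by simp
  have rate_nonneg: "0 \<le> dir_rate d A x"
    unfolding dir_rate_def using L \<open>1 / 21 \<le> ln ?N\<close> pos by (intro divide_nonneg_nonneg) auto
  have "E \<le> C * dir_rate d A x" if "E * ?N * \<gamma>\<^sup>2 \<le> M * (1 + ?L)" for E
  proof -
    from that * have "E * (?N * \<gamma>\<^sup>2) \<le> M * (21 * (?L + ln ?N))" by (simp add: mult.assoc)
    then have "E \<le> M * (21 * (?L + ln ?N)) / (?N * \<gamma>\<^sup>2)" using pos by (simp add: pos_le_divide_eq)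
    also have "\<dots> = 21 * M * dir_rate d A x" by (simp add: dir_rate_def mult_ac)
    also have "\<dots> \<le> C * dir_rate d A x" using C(1) rate_nonneg by (rule mult_right_mono)
    finally show ?thesis .
  qed
  from this[OF D] this[OF D'] have max: "max D D' \<le> C * dir_rate d A x" by simp
  have "(?L + ln ?N) / ?N \<le> (4 + 1 / c) * ((?L + ln (ln t)) / ln t)"
    using ln_ge_8_5[OF assms(4)] N L assms(3) by (intro ln_quotient_compare) auto
  then have "(?L + ln ?N) / ?N / \<gamma>\<^sup>2 \<le> (4 + 1 / c) * ((?L + ln (ln t)) / ln t) / \<gamma>\<^sup>2"
    using \<gamma> by (intro divide_right_mono) auto
  then have le: "dir_rate d A x \<le> (4 + 1 / c) * dir_rate_t d A t"
    by (simp add: dir_rate_def dir_rate_t_def mult.commute)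
  have "(4 + 1 / c) * dir_rate_t d A t \<le> C * dir_rate_t d A t"
  proof (rule mult_right_mono[OF C(2)])
    \<comment> \<open>The sign of \<open>dir_rate_t\<close> is inherited from
      \<open>dir_rate\<close> through the bound just shown.\<close>
    have "0 < 4 + 1 / c" using assms(3) by (simp add: add_pos_pos)
    moreover have "0 \<le> (4 + 1 / c) * dir_rate_t d A t" using le rate_nonneg by linarith
    ultimately show "0 \<le> dir_rate_t d A t" by (simp only: zero_le_mult_iff) linarith
  qed
  with max le show ?thesis by linarith
qed

lemma sum_inverse_sqrt_ge: "sqrt t \<le> (\<Sum>j<t. 1 / sqrt (real j + 1))"
proof (cases "t = 0")
  case False
  have "(\<Sum>j<t. 1 / sqrt t) \<le> (\<Sum>j<t. 1 / sqrt (real j + 1))"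
    by (intro sum_mono divide_left_mono) auto
  moreover have "(\<Sum>j<t. 1 / sqrt t) = sqrt t" using False by (simp add: real_div_sqrt)
  ultimately show ?thesis by simp
qed simp

lemma Rsup_nonneg:
  assumes "1 \<le> t"
  shows "0 \<le> Rsup l d A t"
  unfolding Rsup_def using assms
  by (intro cSUP_upper2[where x = 0]) auto

section \<open>Sublevel radii and lower bounds on the norm of the iterates\<close>

context decaying_loss
begin

lemma data_descentI:
  assumes "data_matrix d A" "\<And>j. 0 < \<eta> j" "\<And>j. \<eta> j \<le> 1"
  shows "data_descent d l l' l'' A \<eta>"
  by unfold_locales (use assms in \<open>auto simp: data_matrix_def\<close>)

text \<open>The level refers to the value at 0, which involves only l and B;
  \<open>radius_transfer\<close> passes to the level \<open>L0 + 1\<close>, which is no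
  larger.\<close>

lemma sublevel_radius:
  assumes "balanced B"
  obtains \<rho> where "0 \<le> \<rho>"
    "\<And>v. v \<in> span (set B) \<Longrightarrow> Loss l (B \<odot> v) \<le> Loss l (B \<odot> 0) + 1 \<Longrightarrow> norm v \<le> \<rho>"
proof -
  obtain \<delta> where \<delta>: "0 < \<delta>" "\<And>v. v \<in> span (set B) \<Longrightarrow> \<delta> * norm v \<le> Loss l (B \<odot> v)"
    using Loss_coercive[OF assms] by blast
  show ?thesis
  proof
    show "0 \<le> (Loss l (B \<odot> 0) + 1) / \<delta>" using \<delta>(1) Loss_nonneg[of B 0] by simp
    fix v assume "v \<in> span (set B)" "Loss l (B \<odot> v) \<le> Loss l (B \<odot> 0) + 1"
    then have "\<delta> * norm v \<le> Loss l (B \<odot> 0) + 1" using \<delta>(2) by fastforce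
    then show "norm v \<le> (Loss l (B \<odot> 0) + 1) / \<delta>" using \<delta>(1) by (simp add: pos_le_divide_eq mult.commute)
  qed
qed

end

lemma (in data_descent) radius_transfer:
  assumes "\<And>v. v \<in> span (set (As d A)) \<Longrightarrow> Loss l (As d A \<odot> v) \<le> Loss l (As d A \<odot> 0) + 1 \<Longrightarrow> norm v \<le> \<rho>"
    and "v \<in> S d A" "Loss l (As d A \<odot> v) \<le> L0 + 1"
  shows "norm v \<le> \<rho>"
  using assms vbar_min[of 0] subspace_0[OF subspace_S] by (auto simp: S_span)

lemma balanced_Nil: "balanced []"
  by (simp add: balanced_def)

text \<open>The fourth power of \<gamma> turns the condition on t into ln t + 4 ln \<gamma> \<ge> 0,
  so \<gamma> costs at most a quarter of ln t. The factor 4 of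
  \<open>ln_le_of_exponential_growth\<close> makes 3/16 of the remaining 3/4.\<close>

lemma (in data_descent) separable_norm_growth:
  assumes sep: "separable d A" and \<eta>: "\<And>j. \<eta> j = 1" and t: "5 \<le> t"
    and cond: "real n / \<gamma> ^ 4 \<le> real t / ln (real t) ^ 3"
  shows "21 / 20 \<le> norm (w t)" "3 / 16 * ln t \<le> norm (w t)"
proof -
  note decomp = separable_decomposition[OF sep]
  have Ac: "Ac d A \<noteq> []" using decomp(2) rows_nonempty by simp
  note \<gamma> = margin_pos[OF Ac] margin_le[OF Ac]
  let ?s = "inner (w t) u" and ?N = "norm (w t)"
  have "(8 / 5) ^ 3 \<le> ln (real t) ^ 3" using ln_ge_8_5[OF t] by (intro power_mono) auto
  then have ln3: "4096 / 1000 \<le> ln (real t) ^ 3" by (simp add: power_divide)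
  then have "0 < ln (real t) ^ 3" by linarith
  have "n * ln (real t) ^ 3 \<le> t * \<gamma> ^ 4"
    using cond \<gamma> \<open>0 < ln (real t) ^ 3\<close> by (simp add: field_simps)
  moreover have "\<gamma> ^ 4 \<le> \<gamma>" using power_decreasing[of 1 4 \<gamma>] \<gamma> by simp
  then have "t * \<gamma> ^ 4 \<le> t * \<gamma>" by (intro mult_left_mono) auto
  ultimately have n: "n * ln (real t) ^ 3 \<le> t * \<gamma>" by linarith
  have T: "(\<Sum>j<t. \<eta> j) = t" by (simp add: \<eta>)
  have lower: "4096 / 1000 \<le> \<gamma> * t / n"
  proof -
    have "4096 / 1000 * real n \<le> ln (real t) ^ 3 * n" using ln3 by (rule mult_right_mono) simp
    with n have "4096 / 1000 * real n \<le> \<gamma> * t" by (simp only: mult.commute)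
    then show ?thesis using n_pos by (subst pos_le_divide_eq) auto
  qed
  \<comment> \<open>Below 21/20 the growth inequality would bound \<gamma> t / n by 4.0635, against
    the lower bound 4.096.\<close>
  have "21 / 20 \<le> ?s"
  proof (rule ccontr)
    assume s: "\<not> 21 / 20 \<le> ?s"
    then have "exp ?s \<le> exp (21 / 20)" by simp
    then have e: "1 + exp ?s \<le> 387 / 100" using exp_21_20_le by linarith
    have "\<gamma> * t / n / (1 + exp ?s) \<le> ?s"
      using growth_separable[OF Ac decomp(3), of t] unfolding T by (simp add: divide_divide_eq_left)
    then have "\<gamma> * t / n \<le> ?s * (1 + exp ?s)"
      by (subst (asm) pos_divide_le_eq) (auto simp: add_pos_pos)
    also have "\<dots> \<le> 21 / 20 * (387 / 100)"
      using s e inner_w_ubar_nonneg[OF Ac] by (intro mult_mono) auto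
    finally show False using lower by linarith
  qed
  then show N: "21 / 20 \<le> ?N" using inner_ubar_le_norm[OF Ac, of "w t"] by linarith
  have "\<gamma> * t / (1 + exp (2 * ?N)) \<le> ?N"
    using growth[OF Ac, of t] inner_ubar_le_norm[OF Ac, of "w t"] n_pos unfolding T decomp(2) by simp
  then have "\<gamma> * t \<le> ?N * (1 + exp (2 * ?N))" by (simp add: pos_divide_le_eq add_pos_pos)
  then have "ln (\<gamma> * t) \<le> 4 * ?N" using \<gamma> t N by (intro ln_le_of_exponential_growth) auto
  moreover have "3 / 4 * ln t \<le> ln (\<gamma> * t)"
  proof -
    have "1 \<le> real n" using n_pos by (simp add: Suc_le_eq)
    then have "1 * 1 \<le> real n * ln (real t) ^ 3" using ln3 by (intro mult_mono) auto
    then have "1 \<le> t * \<gamma> ^ 4" using \<open>n * ln (real t) ^ 3 \<le> t * \<gamma> ^ 4\<close> by linarith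
    then have "0 \<le> ln (t * \<gamma> ^ 4)" by simp
    also have "\<dots> = ln t + 4 * ln \<gamma>" using t \<gamma> by (simp add: ln_mult ln_realpow)
    finally show ?thesis using t \<gamma> by (simp add: ln_mult)
  qed
  ultimately show "3 / 16 * ln t \<le> ?N" by simp
qed

text \<open>With y = ln t, y^3 \<le> exp (y / 2) fails for 8/5 \<le> y < 3: up to 2 because exp 1 <
  3 < 4.096, beyond 2 because exp 2 < 8. The resulting bound 27 on y^3 leaves room for the cruder
  exponent 2 |w_t| in \<open>growth\<close>.\<close>

lemma general_cond_ln_ge_3:
  fixes t :: nat
  assumes "5 \<le> t" "ln (real t) ^ 3 \<le> sqrt t"
  shows "3 \<le> ln (real t)"
proof (rule ccontr)
  assume less: "\<not> 3 \<le> ln (real t)"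
  let ?y = "ln (real t)"
  have "8 / 5 \<le> ?y" by (rule ln_ge_8_5[OF assms(1)])
  have "exp (?y / 2) ^ 2 = exp ?y" by (simp flip: exp_of_nat_mult)
  then have sqrt: "sqrt t = exp (?y / 2)" using assms(1) by (intro real_sqrt_unique) auto
  show False
  proof (cases "?y \<le> 2")
    case True
    then have "exp (?y / 2) \<le> exp 1" by simp
    then have "exp (?y / 2) < 3" using e_less_272 by linarith
    moreover have "(8 / 5) ^ 3 \<le> ?y ^ 3" using \<open>8 / 5 \<le> ?y\<close> by (intro power_mono) auto
    ultimately show False using assms(2) unfolding sqrt by (simp add: power_divide)
  next
    case False
    have "exp (?y / 2) \<le> exp 2" using less by simp
    also have "exp 2 = exp 1 * exp (1 :: real)" by (simp flip: exp_add)
    also have "\<dots> \<le> (272 / 100) * (272 / 100)" using e_less_272 by (intro mult_mono) auto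
    finally have "exp (?y / 2) < 8" by simp
    moreover have "2 ^ 3 \<le> ?y ^ 3" using False by (intro power_mono) auto
    ultimately show False using assms(2) unfolding sqrt by simp
  qed
qed

lemma (in data_descent) general_norm_growth:
  assumes \<eta>: "\<eta> = (\<lambda>j. 1 / sqrt (real j + 1))" and Ac: "Ac d A \<noteq> []" and cond: "general_cond l d A t"
  shows "21 / 20 \<le> norm (w t)"
    "ln t \<le> (16 + 4 * ln (length (As d A) + 1)) * norm (w t)"
proof -
  note \<gamma> = margin_pos[OF Ac] margin_le[OF Ac]
  let ?N = "norm (w t)" and ?k = "real (length (As d A) + 1)"
  have t: "5 \<le> t" using cond by (simp add: general_cond_def)
  have ln_pos: "0 < ln (real t)" using ln_ge_8_5[OF t] by linarith
  have "real n * 1 * inv_margin_sq d A \<le> real n * (1 + Rsup l d A t) * inv_margin_sq d A"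
    using Rsup_nonneg[of t l d A] t by (intro mult_right_mono mult_left_mono) (auto simp: inv_margin_sq_def)
  also have "\<dots> \<le> sqrt t / ln t ^ 3" using cond by (simp add: general_cond_def)
  finally have "n * ln t ^ 3 \<le> sqrt t * \<gamma>\<^sup>2"
    using Ac \<gamma> ln_pos by (simp add: inv_margin_sq_def field_simps)
  then have *: "n * ln t ^ 3 \<le> sqrt t * \<gamma> * \<gamma>" by (simp add: power2_eq_square mult.assoc)
  moreover have "sqrt t * \<gamma> * \<gamma> \<le> sqrt t * \<gamma> * 1" using \<gamma> by (intro mult_left_mono) auto
  ultimately have n: "n * ln t ^ 3 \<le> sqrt t * \<gamma>" by linarith
  have n1: "1 \<le> real n" using n_pos by (simp add: Suc_le_eq)
  have "1 * ln t ^ 3 \<le> n * ln t ^ 3" using n1 ln_pos by (intro mult_right_mono) auto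
  moreover have "sqrt t * \<gamma> \<le> sqrt t * 1" using \<gamma> by (intro mult_left_mono) auto
  ultimately have "3 \<le> ln (real t)" using n t by (intro general_cond_ln_ge_3) linarith+
  then have ln3: "3 ^ 3 \<le> ln (real t) ^ 3" by (intro power_mono) auto
  define c where "c = length (Ac d A) / real n"
  have Ac1: "1 \<le> real (length (Ac d A))" using Ac by (simp add: Suc_le_eq)
  then have c: "1 / n \<le> c" unfolding c_def by (intro divide_right_mono) auto
  \<comment> \<open>The constant may contain the number of rows of \<open>A_S\<close> but not n; for
    given \<open>A_S\<close> the share of \<open>A_c\<close> is smallest with a single row in
    it.\<close>
  have c': "1 / ?k \<le> c"
  proof -
    have "real (length (As d A)) * 1 \<le> real (length (As d A)) * real (length (Ac d A))"
      using Ac1 by (intro mult_left_mono) auto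
    then have "real n \<le> length (Ac d A) * ?k"
      unfolding length_As_Ac[of A d] by (simp add: algebra_simps)
    then show ?thesis using n_pos by (simp add: c_def divide_simps)
  qed
  have "\<gamma> * sqrt t * (c / (1 + exp (2 * ?N))) \<le> \<gamma> * (\<Sum>j<t. \<eta> j) * (c / (1 + exp (2 * ?N)))"
    using \<gamma> sum_inverse_sqrt_ge[of t] unfolding \<eta>
    by (intro mult_right_mono mult_left_mono) (auto simp: c_def add_nonneg_nonneg)
  also have "\<dots> \<le> ?N"
    using growth[OF Ac, of t] inner_ubar_le_norm[OF Ac, of "w t"] unfolding c_def by linarith
  finally have main: "\<gamma> * sqrt t * c \<le> ?N * (1 + exp (2 * ?N))"
    by (simp add: pos_divide_le_eq add_pos_pos)
  show N: "21 / 20 \<le> ?N"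
  proof (rule ccontr)
    assume N: "\<not> 21 / 20 \<le> ?N"
    \<comment> \<open>For the threshold the share 1/n is enough, since the condition on t carries
      the factor n.\<close>
    have "ln t ^ 3 \<le> \<gamma> * sqrt t * (1 / n)" using n n_pos by (simp add: field_simps)
    also have "\<dots> \<le> \<gamma> * sqrt t * c" using c \<gamma> by (intro mult_left_mono) auto
    also note main
    also have "?N * (1 + exp (2 * ?N)) \<le> 21 / 20 * (1 + (287 / 100) * (287 / 100))"
    proof (intro mult_mono add_mono)
      have *: "exp (2 * ?N) = exp ?N * exp ?N" by (simp flip: exp_add)
      have "exp ?N \<le> exp (21 / 20)" using N by simp
      then have "exp ?N \<le> 287 / 100" using exp_21_20_le by linarith
      then have "exp ?N * exp ?N \<le> (287 / 100) * (287 / 100)" by (intro mult_mono) auto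
      with * show "exp (2 * ?N) \<le> (287 / 100) * (287 / 100)" by simp
    qed (use N in \<open>auto simp: add_nonneg_nonneg\<close>)
    finally show False using ln3 by simp
  qed
  have "ln (\<gamma> * sqrt t * (1 / ?k)) \<le> 4 * ?N"
  proof (rule ln_le_of_exponential_growth)
    have "\<gamma> * sqrt t * (1 / ?k) \<le> \<gamma> * sqrt t * c" using c' \<gamma> by (intro mult_left_mono) auto
    with main show "\<gamma> * sqrt t * (1 / ?k) \<le> ?N * (1 + exp (2 * ?N))" by linarith
  qed (use \<gamma> t N in auto)
  moreover have "ln (\<gamma> * sqrt t * (1 / ?k)) = ln (\<gamma> * sqrt t) - ln ?k"
    using \<gamma> t by (simp add: ln_div)
  \<comment> \<open>Here the condition gives ln t / 2 + 2 ln \<gamma> \<ge> 0, so \<gamma> costs at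
    most half of ln (sqrt t).\<close>
  moreover have "1 / 4 * ln t \<le> ln (\<gamma> * sqrt t)"
  proof -
    have "1 * 1 \<le> n * ln t ^ 3" using n1 ln3 by (intro mult_mono) auto
    then have "0 \<le> ln (sqrt t * \<gamma> * \<gamma>)" using * by simp
    also have "\<dots> = ln t / 2 + 2 * ln \<gamma>" using t \<gamma> by (simp add: ln_mult ln_sqrt)
    finally show ?thesis using t \<gamma> by (simp add: ln_mult ln_sqrt)
  qed
  moreover have "ln ?k * 1 \<le> ln ?k * ?N" using N by (intro mult_left_mono) auto
  ultimately show "ln t \<le> (16 + 4 * ln ?k) * ?N" by (simp add: algebra_simps)
qed

section \<open>Directional bounds with constants uniform in the data\<close>

context decaying_loss
begin

lemma separable_case:
  "\<exists>C>0. \<forall>d A. data_matrix d A \<and> separable d A \<longrightarrow>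
     Sperp d A = Rd d \<and> Ac d A = A \<and> Aperp d A = A \<and>
     (\<forall>z\<in>set (A \<odot> ubar d A). z \<le> - margin d A) \<and>
     (\<forall>t b. t \<ge> 5 \<and> real t / ln (real t) ^ 3 \<ge> real (length A) / margin d A ^ 4 \<and>
        ball_minimizer l d A (w_const l A t) b \<longrightarrow>
        max (dir_error d A (w_const l A t)) (dir_error d A b)
          \<le> C * dir_rate d A (w_const l A t) \<and>
        dir_rate d A (w_const l A t) \<le> C * dir_rate_t d A t)"
proof -
  \<comment> \<open>In the separable case \<open>A_S\<close> has no rows, so the radius and with it
    the constant are absolute.\<close>
  obtain \<rho> where \<rho>: "0 \<le> \<rho>"
    "\<And>v. v \<in> span (set []) \<Longrightarrow> Loss l ([] \<odot> v) \<le> Loss l ([] \<odot> 0) + 1 \<Longrightarrow> norm v \<le> \<rho>"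
    using sublevel_radius[OF balanced_Nil] by blast
  define M where "M = 40 * \<rho> + 28"
  \<comment> \<open>10 exceeds \<open>4 + 1 / c\<close> for c = 3/16.\<close>
  define C where "C = 21 * M + 10"
  have "0 \<le> M" using \<rho>(1) by (simp add: M_def)
  show ?thesis
  proof (intro exI[of _ C] conjI allI impI)
    show "0 < C" using \<open>0 \<le> M\<close> by (simp add: C_def)
    fix d A assume "data_matrix d A \<and> separable d A"
    then have dA: "data_matrix d A" "separable d A" by auto
    interpret data_descent d l l' l'' A "\<lambda>_. 1" by (rule data_descentI[OF dA(1)]) auto
    note decomp = separable_decomposition[OF dA(2)]
    have Ac: "Ac d A \<noteq> []" using decomp(2) rows_nonempty by simp
    show "Sperp d A = Rd d" "Ac d A = A" "Aperp d A = A" by fact+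
    show "\<forall>z\<in>set (A \<odot> ubar d A). z \<le> - margin d A"
      using Ac_inner_ubar[OF Ac] unfolding decomp(2) by (auto simp: matvec_def)
    fix t b
    assume "t \<ge> 5 \<and> real t / ln (real t) ^ 3 \<ge> real (length A) / margin d A ^ 4 \<and>
      ball_minimizer l d A (w_const l A t) b"
    then have t: "5 \<le> t" "real n / \<gamma> ^ 4 \<le> real t / ln (real t) ^ 3"
      and b: "ball_minimizer l d A (w t) b" by auto
    note N = separable_norm_growth[OF dA(2) refl t]
    have rad: "norm v \<le> \<rho>" if "v \<in> S d A" "Loss l (As d A \<odot> v) \<le> L0 + 1" for v
      using radius_transfer[of \<rho> v] \<rho>(2) that unfolding decomp(1) by blast
    have "max (dir_error d A (w t)) (dir_error d A b) \<le> C * dir_rate d A (w t) \<and>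
        dir_rate d A (w t) \<le> C * dir_rate_t d A t"
    proof (rule dir_rate_bounds[OF Ac \<open>0 \<le> M\<close> _ t(1) N])
      show "dir_error d A (w t) * norm (w t) * \<gamma>\<^sup>2 \<le> M * (1 + ln n)"
        unfolding M_def using N(1) by (intro dir_error_w_le[OF Ac rad]) auto
      show "dir_error d A b * norm (w t) * \<gamma>\<^sup>2 \<le> M * (1 + ln n)"
        unfolding M_def using N(1) by (intro dir_error_ball_minimizer_le[OF Ac rad b]) auto
    qed (use \<open>0 \<le> M\<close> in \<open>auto simp: C_def\<close>)
    then show "max (dir_error d A (w t)) (dir_error d A b) \<le> C * dir_rate d A (w t)"
      "dir_rate d A (w t) \<le> C * dir_rate_t d A t" by auto
  qed
qed

lemma general_direction:
  "\<forall>B. \<exists>C>0. \<forall>d A. data_matrix d A \<and> As d A = B \<and> Ac d A \<noteq> [] \<longrightarrow>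
     (\<forall>t b. general_cond l d A t \<and> ball_minimizer l d A (w_decay l A t) b \<longrightarrow>
        max (dir_error d A (w_decay l A t)) (dir_error d A b)
          \<le> C * dir_rate d A (w_decay l A t) \<and>
        dir_rate d A (w_decay l A t) \<le> C * dir_rate_t d A t)"
proof
  fix B :: "rvec list"
  show "\<exists>C>0. \<forall>d A. data_matrix d A \<and> As d A = B \<and> Ac d A \<noteq> [] \<longrightarrow>
     (\<forall>t b. general_cond l d A t \<and> ball_minimizer l d A (w_decay l A t) b \<longrightarrow>
        max (dir_error d A (w_decay l A t)) (dir_error d A b)
          \<le> C * dir_rate d A (w_decay l A t) \<and>
        dir_rate d A (w_decay l A t) \<le> C * dir_rate_t d A t)"
  proof (cases "balanced B")
    case True
    obtain \<rho> where \<rho>: "0 \<le> \<rho>"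
      "\<And>v. v \<in> span (set B) \<Longrightarrow> Loss l (B \<odot> v) \<le> Loss l (B \<odot> 0) + 1 \<Longrightarrow> norm v \<le> \<rho>"
      using sublevel_radius[OF True] by blast
    define M where "M = 40 * \<rho> + 28"
    define k where "k = 16 + 4 * ln (real (length B + 1))"
    define C where "C = 21 * M + 4 + k"
    have "0 \<le> M" using \<rho>(1) by (simp add: M_def)
    have "0 < k" by (simp add: k_def add_pos_nonneg)
    show ?thesis
    proof (intro exI[of _ C] conjI allI impI)
      show "0 < C" using \<open>0 \<le> M\<close> \<open>0 < k\<close> by (simp add: C_def)
      fix d A t b assume "data_matrix d A \<and> As d A = B \<and> Ac d A \<noteq> []"
      then have dA: "data_matrix d A" "As d A = B" and Ac: "Ac d A \<noteq> []" by auto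
      interpret data_descent d l l' l'' A "\<lambda>j. 1 / sqrt (real j + 1)"
        by (rule data_descentI[OF dA(1)]) auto
      assume "general_cond l d A t \<and> ball_minimizer l d A (w_decay l A t) b"
      then have cond: "general_cond l d A t" and b: "ball_minimizer l d A (w t) b" by auto
      have t: "5 \<le> t" using cond by (simp add: general_cond_def)
      note N = general_norm_growth[OF refl Ac cond]
      have N': "1 / k * ln t \<le> norm (w t)"
        using N(2) \<open>0 < k\<close> unfolding dA(2) k_def[symmetric] by (simp add: divide_le_eq mult.commute)
      have rad: "norm v \<le> \<rho>" if "v \<in> S d A" "Loss l (As d A \<odot> v) \<le> L0 + 1" for v
        using radius_transfer[of \<rho> v] \<rho>(2) that unfolding dA(2) by blast
      have "max (dir_error d A (w t)) (dir_error d A b) \<le> C * dir_rate d A (w t) \<and>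
          dir_rate d A (w t) \<le> C * dir_rate_t d A t"
      proof (rule dir_rate_bounds[OF Ac \<open>0 \<le> M\<close> _ t N(1) N'])
        show "dir_error d A (w t) * norm (w t) * \<gamma>\<^sup>2 \<le> M * (1 + ln n)"
          unfolding M_def using N(1) by (intro dir_error_w_le[OF Ac rad]) auto
        show "dir_error d A b * norm (w t) * \<gamma>\<^sup>2 \<le> M * (1 + ln n)"
          unfolding M_def using N(1) by (intro dir_error_ball_minimizer_le[OF Ac rad b]) auto
      qed (use \<open>0 \<le> M\<close> \<open>0 < k\<close> in \<open>auto simp: C_def\<close>)
      then show "max (dir_error d A (w t)) (dir_error d A b) \<le> C * dir_rate d A (w t)"
        "dir_rate d A (w t) \<le> C * dir_rate_t d A t" by auto
    qed
  next
    case False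
    \<comment> \<open>An unbalanced B never occurs as \<open>As d A\<close>, so any constant will
      do.\<close>
    then show ?thesis using data.balanced_As[OF data.intro] by (intro exI[of _ 1]) auto
  qed
qed

end

section \<open>Projections to S and its complement for fixed data\<close>

locale decaying_step_descent = data_descent d l l' l'' A "\<lambda>j. 1 / sqrt (real j + 1)"
  for d l l' l'' A
begin

lemma proj_bounded: obtains P where "0 < P" "\<And>j. norm (\<pi> (w j)) \<le> P"
proof -
  obtain \<rho> where \<rho>: "0 \<le> \<rho>" "\<And>v. v \<in> span (set (As d A)) \<Longrightarrow>
      Loss l (As d A \<odot> v) \<le> Loss l (As d A \<odot> 0) + 1 \<Longrightarrow> norm v \<le> \<rho>"
    using sublevel_radius[OF balanced_As] by blast
  have bound: "norm (\<pi> (w j)) \<le> (4 * \<rho> + 2 * ln n) / rate" for j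
    using radius_transfer[of \<rho>] \<rho>(2) by (intro norm_proj_w_le) blast
  show ?thesis
  proof
    show "0 < (4 * \<rho> + 2 * ln n) / rate + 1"
      using \<rho>(1) ln_n_nonneg rate_pos by (intro add_nonneg_pos divide_nonneg_pos) auto
    show "norm (\<pi> (w j)) \<le> (4 * \<rho> + 2 * ln n) / rate + 1" for j
      using bound[of j] by linarith
  qed
qed

lemma excess_risk_rate:
  obtains C where "0 < C" "\<And>t. 5 \<le> t \<Longrightarrow> n * R (w t) - L0 \<le> C * (ln (real t) ^ 2 / sqrt (real t))"
proof
  let ?V = "norm v0"
  define C where "C = n * (exp ?V + (?V + 1 / rate)\<^sup>2)"
  show "0 < C" unfolding C_def using n_pos by (intro mult_pos_pos add_pos_nonneg) auto
  fix t :: nat assume t: "5 \<le> t"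
  define y where "y = ln (real t)"
  have y: "1 \<le> y" using ln_ge_8_5[OF t] by (simp add: y_def)
  have y2: "1 \<le> y\<^sup>2" using y by (simp add: power2_eq_square mult_ge1_I)
  \<comment> \<open>The choice r = y / \<open>rate\<close> makes the first term of order 1/t and the
    second of order y^2 / sqrt t, as the steps add up to at least sqrt t.\<close>
  have "n * R (w t) - L0 \<le> n * exp (?V - rate * (y / rate)) + n * (?V + y / rate)\<^sup>2 / (2 * sqrt t)"
    using t y rate_pos by (intro excess_risk_le sum_inverse_sqrt_ge) auto
  also have "exp (?V - rate * (y / rate)) = exp ?V * (1 / t)"
    using t rate_pos by (simp add: exp_diff y_def)
  also have "1 / real t \<le> y\<^sup>2 / sqrt t"
  proof -
    have "sqrt t * 1 \<le> sqrt t * sqrt t" using t by (intro mult_left_mono) auto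
    also have "sqrt t * sqrt t = real t * 1" by simp
    also have "\<dots> \<le> real t * y\<^sup>2" using y2 by (intro mult_left_mono) auto
    finally have "sqrt t * 1 \<le> real t * y\<^sup>2" .
    then have "1 * sqrt t \<le> y\<^sup>2 * t" by (simp only: mult.commute)
    then have "1 \<le> y\<^sup>2 * t / sqrt t" using t by (subst pos_le_divide_eq) auto
    then show ?thesis using t by (subst pos_divide_le_eq) auto
  qed
  then have "n * (exp ?V * (1 / t)) \<le> n * (exp ?V * (y\<^sup>2 / sqrt t))" by (intro mult_left_mono) auto
  also have "n * (?V + y / rate)\<^sup>2 / (2 * sqrt t) \<le> n * ((?V + 1 / rate)\<^sup>2 * (y\<^sup>2 / sqrt t))"
  proof -
    have "?V * 1 \<le> ?V * y" using y by (intro mult_left_mono) auto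
    then have "?V + y / rate \<le> (?V + 1 / rate) * y" by (simp add: algebra_simps)
    then have "(?V + y / rate)\<^sup>2 \<le> ((?V + 1 / rate) * y)\<^sup>2"
      using y rate_pos by (intro power_mono) (auto intro!: add_nonneg_nonneg)
    then have "n * (?V + y / rate)\<^sup>2 / (2 * sqrt t) \<le> n * ((?V + 1 / rate) * y)\<^sup>2 / (1 * sqrt t)"
      using t by (intro frac_le mult_left_mono mult_right_mono) auto
    then show ?thesis by (simp add: power_mult_distrib)
  qed
  finally show "n * R (w t) - L0 \<le> C * (ln (real t) ^ 2 / sqrt (real t))"
    by (simp add: C_def y_def algebra_simps)
qed

text \<open>Stated for every x of risk at most R(w_t), so that it covers ball minimizers as well as
  w_t. The excess risk bounds the excess loss on \<open>A_S\<close>, which quadratic growth turns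
  into a distance.\<close>

lemma proj_rate:
  obtains C where "0 < C"
    "\<And>t x. 5 \<le> t \<Longrightarrow> R x \<le> R (w t) \<Longrightarrow> (norm (\<pi> x - v0))\<^sup>2 \<le> C * (ln (real t) ^ 2 / sqrt (real t))"
proof -
  obtain C where C: "0 < C" "\<And>t. 5 \<le> t \<Longrightarrow> n * R (w t) - L0 \<le> C * (ln (real t) ^ 2 / sqrt (real t))"
    using excess_risk_rate by blast
  obtain \<delta> where \<delta>: "0 < \<delta>" "\<And>v. v \<in> span (set (As d A)) \<Longrightarrow> \<delta> * norm v \<le> Loss l (As d A \<odot> v)"
    using Loss_coercive[OF balanced_As] by blast
  \<comment> \<open>Risk at most 1 means loss at most n, which by coercivity confines the
    projections to this ball.\<close>
  obtain c where c: "0 < c" "\<And>v. v \<in> span (set (As d A)) \<Longrightarrow> norm v \<le> n / \<delta> \<Longrightarrow>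
      c * (norm (v - v0))\<^sup>2 \<le> Loss l (As d A \<odot> v) - L0"
    using Loss_quadratic_growth[of v0 "As d A" "n / \<delta>"] vbar_mem vbar_min norm_row_le set_As_Ac(1)
    unfolding S_span by blast
  show ?thesis
  proof
    show "0 < C / c" using C c by simp
    fix t :: nat and x assume t: "5 \<le> t" and x: "R x \<le> R (w t)"
    have px: "\<pi> x \<in> span (set (As d A))" using proj_S_mem by (simp add: S_span)
    have le: "Loss l (As d A \<odot> \<pi> x) \<le> n * R (w t)"
      using Loss_As_le_risk[of x] mult_left_mono[OF x, of n] by simp
    also have "\<dots> \<le> n" using mult_left_mono[OF risk_w_le_1[of t], of n] by simp
    finally have "\<delta> * norm (\<pi> x) \<le> n" using \<delta>(2)[OF px] by linarith
    then have "norm (\<pi> x) \<le> n / \<delta>" using \<delta>(1) by (simp add: pos_le_divide_eq mult.commute)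
    from c(2)[OF px this] le C(2)[OF t]
    have "c * (norm (\<pi> x - v0))\<^sup>2 \<le> C * (ln (real t) ^ 2 / sqrt (real t))" by linarith
    then have "(norm (\<pi> x - v0))\<^sup>2 \<le> C * (ln (real t) ^ 2 / sqrt (real t)) / c"
      unfolding pos_le_divide_eq[OF c(1)] by (simp only: mult.commute)
    then show "(norm (\<pi> x - v0))\<^sup>2 \<le> C / c * (ln (real t) ^ 2 / sqrt (real t))"
      by (simp only: times_divide_eq_left)
  qed
qed

text \<open>The projections converge to \<open>vbar\<close>, so they are bounded away from 0 for
  large t exactly when \<open>vbar\<close> is nonzero.\<close>

lemma proj_eventually_ge:
  assumes "v0 \<noteq> 0"
  shows "\<exists>c>0. \<forall>\<^sub>F t in sequentially. c \<le> norm (\<pi> (w t))"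
proof -
  obtain C where C: "0 < C" "\<And>t x. 5 \<le> t \<Longrightarrow> R x \<le> R (w t) \<Longrightarrow>
      (norm (\<pi> x - v0))\<^sup>2 \<le> C * (ln (real t) ^ 2 / sqrt (real t))"
    using proj_rate by blast
  let ?c = "norm v0 / 2"
  have c: "0 < ?c" using assms by simp
  have "(\<lambda>t::nat. C * (ln (real t) ^ 2 / sqrt (real t))) \<longlonglongrightarrow> 0" by real_asymp
  then have "\<forall>\<^sub>F t in sequentially. C * (ln (real t) ^ 2 / sqrt (real t)) < ?c\<^sup>2"
    using c by (intro order_tendstoD(2)[of _ 0]) auto
  then have "\<forall>\<^sub>F t in sequentially. ?c \<le> norm (\<pi> (w t))"
    using eventually_ge_at_top[of 5]
  proof eventually_elim
    case (elim t)
    then have "(norm (\<pi> (w t) - v0))\<^sup>2 \<le> ?c\<^sup>2" using C(2)[of t "w t"] by linarith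
    then have "norm (\<pi> (w t) - v0) \<le> ?c" by (rule power2_le_imp_le) simp
    then show ?case using norm_triangle_ineq2[of v0 "\<pi> (w t)"] by (simp add: norm_minus_commute)
  qed
  with c show ?thesis by blast
qed

text \<open>The constants may depend on the data here, so the bound P on the projections is absorbed
  into \<kappa>, and every t \<ge> 5 is covered.\<close>

lemma residual_growth:
  assumes Ac: "Ac d A \<noteq> []"
  obtains c C where "0 < c" "0 < C"
    "\<And>t. 5 \<le> t \<Longrightarrow> c * ln (real t) \<le> norm (w t - \<pi> (w t))"
    "\<And>t. 5 \<le> t \<Longrightarrow> norm (w t - \<pi> (w t)) \<le> C * ln (real t)"
proof -
  obtain P where P: "0 < P" "\<And>j. norm (\<pi> (w j)) \<le> P" using proj_bounded by blast
  note \<gamma> = margin_pos[OF Ac] margin_le[OF Ac]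
  define m where "m = length (Ac d A) / real n"
  have m: "0 < m" using Ac n_pos by (simp add: m_def)
  define \<kappa> where "\<kappa> = \<gamma> * m / exp (2 * P)"
  have \<kappa>: "0 < \<kappa>" using \<gamma> m by (simp add: \<kappa>_def)
  \<comment> \<open>8 + 2 |ln \<kappa>| serves residuals of norm at least 1. For shorter ones the
    growth inequality gives \<open>sqrt t \<le> 10 / \<kappa> * ?q\<close>, and ln t \<le> 2 sqrt t
    leads to 20 / \<kappa>.\<close>
  define k where "k = 8 + 2 * \<bar>ln \<kappa>\<bar> + 20 / \<kappa>"
  have k: "0 < k" unfolding k_def using \<kappa> by (intro add_pos_pos add_pos_nonneg) auto
  define C where "C = 2 * (norm v0 + 1 / rate) + 2 * exp (norm v0)"
  have "0 < C" unfolding C_def using rate_pos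
    by (intro add_nonneg_pos mult_nonneg_nonneg add_nonneg_nonneg) auto
  have lower: "1 / k * ln (real t) \<le> norm (w t - \<pi> (w t))" if t: "5 \<le> t" for t
  proof -
    let ?q = "norm (w t - \<pi> (w t))"
    have "inner (w t) u = inner (w t - \<pi> (w t)) u"
      using inner_S_ubar[OF Ac proj_S_mem] by (simp add: inner_diff_left)
    then have s: "inner (w t) u \<le> ?q" using inner_ubar_le_norm[OF Ac] by simp
    have "norm (w t) \<le> ?q + P" using norm_triangle_sub[of "w t" "\<pi> (w t)"] P(2)[of t] by linarith
    then have "exp (2 * norm (w t)) \<le> exp (2 * P) * exp (2 * ?q)" by (simp flip: exp_add)
    moreover have "1 \<le> exp (2 * P)" using P(1) by simp
    ultimately have e: "1 + exp (2 * norm (w t)) \<le> exp (2 * P) * (1 + exp (2 * ?q))"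
      unfolding distrib_left mult_1_right by linarith
    have "\<gamma> * sqrt t * (m / (1 + exp (2 * norm (w t))))
        \<le> \<gamma> * (\<Sum>j<t. 1 / sqrt (real j + 1)) * (m / (1 + exp (2 * norm (w t))))"
      using \<gamma> sum_inverse_sqrt_ge[of t]
      by (intro mult_right_mono mult_left_mono) (use m in \<open>auto simp: add_nonneg_nonneg\<close>)
    also have "\<dots> \<le> ?q" using growth[OF Ac, of t, folded m_def] s by linarith
    finally have "\<gamma> * sqrt t * m \<le> ?q * (1 + exp (2 * norm (w t)))"
      by (simp add: pos_divide_le_eq add_pos_pos)
    also have "\<dots> \<le> ?q * (exp (2 * P) * (1 + exp (2 * ?q)))" using e by (intro mult_left_mono) auto
    finally have main: "\<kappa> * sqrt t \<le> ?q * (1 + exp (2 * ?q))"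
      by (simp add: \<kappa>_def pos_divide_le_eq mult_ac)
    have "ln (real t) \<le> k * ?q"
    proof (cases "1 \<le> ?q")
      case True
      have "ln (\<kappa> * sqrt t) \<le> 4 * ?q"
        using \<kappa> t main True by (intro ln_le_of_exponential_growth) auto
      then have "ln t \<le> 8 * ?q - 2 * ln \<kappa>" using \<kappa> t by (simp add: ln_mult ln_sqrt)
      moreover have "- ln \<kappa> \<le> \<bar>ln \<kappa>\<bar> * 1" by simp
      moreover have "\<bar>ln \<kappa>\<bar> * 1 \<le> \<bar>ln \<kappa>\<bar> * ?q" using True by (intro mult_left_mono) auto
      ultimately have "ln t \<le> (8 + 2 * \<bar>ln \<kappa>\<bar>) * ?q" by (simp add: algebra_simps)
      moreover have "0 \<le> 20 / \<kappa> * ?q" using \<kappa> by simp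
      ultimately show ?thesis by (simp only: k_def distrib_right)
    next
      case False
      have "exp (2 * ?q) \<le> exp 2" using False by simp
      also have "exp 2 = exp 1 * exp (1 :: real)" by (simp flip: exp_add)
      also have "\<dots> \<le> (272 / 100) * (272 / 100)" using e_less_272 by (intro mult_mono) auto
      finally have "?q * (1 + exp (2 * ?q)) \<le> ?q * 10" by (intro mult_left_mono) auto
      with main have "sqrt t \<le> 10 / \<kappa> * ?q" using \<kappa> by (simp add: field_simps)
      moreover have "ln t \<le> 2 * sqrt t"
        using ln_le_minus_one[of "sqrt t"] t by (simp add: ln_sqrt)
      moreover have "0 \<le> (8 + 2 * \<bar>ln \<kappa>\<bar>) * ?q" by (intro mult_nonneg_nonneg) auto
      ultimately show ?thesis unfolding k_def distrib_right by linarith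
    qed
    then show ?thesis using k by (simp add: divide_le_eq mult.commute)
  qed
  have upper: "norm (w t - \<pi> (w t)) \<le> C * ln (real t)" if t: "5 \<le> t" for t
  proof -
    have y: "1 \<le> ln (real t)" using ln_ge_8_5[OF t] by linarith
    have "norm (w t - \<pi> (w t)) \<le> norm (w t)"
      using dist_proj_S_le[OF subspace_0[OF subspace_S], of "w t" d A] by simp
    also have "\<dots> \<le> 2 * (norm v0 + ln t / rate) + 2 * exp (norm v0)"
      using t by (intro norm_w_le) simp
    also have "\<dots> \<le> 2 * (norm v0 * ln t + ln t / rate) + 2 * (exp (norm v0) * ln t)"
      using mult_left_mono[OF y norm_ge_zero[of v0], simplified mult_1_right]
        mult_left_mono[OF y exp_ge_zero[of "norm v0"], simplified mult_1_right]
      by (intro add_mono mult_left_mono[of _ _ 2] order_refl) (assumption | simp)+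
    also have "\<dots> = C * ln t" by (simp add: C_def algebra_simps)
    finally show ?thesis .
  qed
  from lower upper k \<open>0 < C\<close> that[of "1 / k" C] show ?thesis by simp
qed

lemma general_projection:
  shows "\<exists>C>0. \<forall>t\<ge>1. Rsup l d A t \<le> C"
    and "\<exists>C>0. \<forall>t. general_cond l d A t \<longrightarrow> norm (\<pi> (w t)) \<le> C"
    and "\<exists>C>0. \<forall>t b. general_cond l d A t \<and> ball_minimizer l d A (w t) b \<longrightarrow>
      max ((norm (\<pi> (w t) - v0))\<^sup>2) ((norm (\<pi> b - v0))\<^sup>2) \<le> C * (ln (real t) ^ 2 / sqrt (real t))"
    and "Ac d A \<noteq> [] \<Longrightarrow> \<exists>c>0. \<exists>C>0. \<forall>t. general_cond l d A t \<longrightarrow>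
      c * ln (real t) \<le> norm (orth_proj (Sperp d A) (w t)) \<and>
      norm (orth_proj (Sperp d A) (w t)) \<le> C * ln (real t)"
proof -
  obtain P where P: "0 < P" "\<And>j. norm (\<pi> (w j)) \<le> P" using proj_bounded by blast
  have "Rsup l d A t \<le> P" if "1 \<le> t" for t
    unfolding Rsup_def using P(2) that by (intro cSUP_least) (auto simp: lessThan_empty_iff)
  with P show "\<exists>C>0. \<forall>t\<ge>1. Rsup l d A t \<le> C"
    "\<exists>C>0. \<forall>t. general_cond l d A t \<longrightarrow> norm (\<pi> (w t)) \<le> C" by blast+
  obtain C where C: "0 < C" "\<And>t x. 5 \<le> t \<Longrightarrow> R x \<le> R (w t) \<Longrightarrow>
      (norm (\<pi> x - v0))\<^sup>2 \<le> C * (ln (real t) ^ 2 / sqrt (real t))"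
    using proj_rate by blast
  have "R b \<le> R (w t)" if "ball_minimizer l d A (w t) b" for t b
    using that w_Rd[of t] by (auto simp: ball_minimizer_def is_arg_min_def not_less)
  with C show "\<exists>C>0. \<forall>t b. general_cond l d A t \<and> ball_minimizer l d A (w t) b \<longrightarrow>
      max ((norm (\<pi> (w t) - v0))\<^sup>2) ((norm (\<pi> b - v0))\<^sup>2) \<le> C * (ln (real t) ^ 2 / sqrt (real t))"
    by (intro exI[of _ C]) (auto simp: general_cond_def)
  assume "Ac d A \<noteq> []"
  then obtain c C where "0 < c" "0 < C"
    "\<And>t. 5 \<le> t \<Longrightarrow> c * ln (real t) \<le> norm (w t - \<pi> (w t))"
    "\<And>t. 5 \<le> t \<Longrightarrow> norm (w t - \<pi> (w t)) \<le> C * ln (real t)"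
    using residual_growth by blast
  then show "\<exists>c>0. \<exists>C>0. \<forall>t. general_cond l d A t \<longrightarrow>
      c * ln (real t) \<le> norm (orth_proj (Sperp d A) (w t)) \<and>
      norm (orth_proj (Sperp d A) (w t)) \<le> C * ln (real t)"
    unfolding proj_Sperp[OF w_Rd] general_cond_def by blast
qed

end

theorem theorem4p1:
  fixes l :: "real \<Rightarrow> real"
  assumes "l \<in> {loss_exp, loss_log}"
  shows
    "(\<exists>C>0. \<forall>d A. data_matrix d A \<and> separable d A \<longrightarrow>
         Sperp d A = Rd d \<and> Ac d A = A \<and> Aperp d A = A \<and>
         (\<forall>z\<in>set (A \<odot> ubar d A). z \<le> - margin d A) \<and>
         (\<forall>t b. t \<ge> 5 \<and> real t / ln (real t) ^ 3 \<ge> real (length A) / margin d A ^ 4 \<and>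
            ball_minimizer l d A (w_const l A t) b \<longrightarrow>
            max (dir_error d A (w_const l A t)) (dir_error d A b)
              \<le> C * dir_rate d A (w_const l A t) \<and>
            dir_rate d A (w_const l A t) \<le> C * dir_rate_t d A t))
     \<and>
     (\<forall>d A. data_matrix d A \<longrightarrow>
         (\<exists>C>0. \<forall>t\<ge>1. Rsup l d A t \<le> C) \<and>
         (\<exists>C>0. \<forall>t. general_cond l d A t \<longrightarrow> norm (orth_proj (S d A) (w_decay l A t)) \<le> C) \<and>
         (vbar l d A \<noteq> 0 \<longrightarrow>
            (\<exists>c>0. \<forall>\<^sub>F t in sequentially. c \<le> norm (orth_proj (S d A) (w_decay l A t)))) \<and>
         (\<exists>C>0. \<forall>t b. general_cond l d A t \<and> ball_minimizer l d A (w_decay l A t) b \<longrightarrow>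
            max ((norm (orth_proj (S d A) (w_decay l A t) - vbar l d A))\<^sup>2)
                ((norm (orth_proj (S d A) b - vbar l d A))\<^sup>2)
              \<le> C * (ln (real t) ^ 2 / sqrt (real t))) \<and>
         (Ac d A \<noteq> [] \<longrightarrow>
            (\<exists>c>0. \<exists>C>0. \<forall>t. general_cond l d A t \<longrightarrow>
               c * ln (real t) \<le> norm (orth_proj (Sperp d A) (w_decay l A t)) \<and>
               norm (orth_proj (Sperp d A) (w_decay l A t)) \<le> C * ln (real t))))
     \<and>
     (\<forall>B. \<exists>C>0. \<forall>d A. data_matrix d A \<and> As d A = B \<and> Ac d A \<noteq> [] \<longrightarrow>
         (\<forall>t b. general_cond l d A t \<and> ball_minimizer l d A (w_decay l A t) b \<longrightarrow>
            max (dir_error d A (w_decay l A t)) (dir_error d A b)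
              \<le> C * dir_rate d A (w_decay l A t) \<and>
            dir_rate d A (w_decay l A t) \<le> C * dir_rate_t d A t))"
proof -
  obtain l' l'' where "decaying_loss l l' l''"
    using assms decaying_loss_exp decaying_loss_log by blast
  then interpret decaying_loss l l' l'' .
  show ?thesis
  proof (intro conjI separable_case general_direction allI impI)
    fix d A assume "data_matrix d A"
    then interpret D: decaying_step_descent d l l' l'' A
      unfolding decaying_step_descent_def by (intro data_descentI) auto
    note D.general_projection D.proj_eventually_ge
    then show "\<exists>C>0. \<forall>t\<ge>1. Rsup l d A t \<le> C"
      "\<exists>C>0. \<forall>t. general_cond l d A t \<longrightarrow> norm (orth_proj (S d A) (w_decay l A t)) \<le> C"
      "vbar l d A \<noteq> 0 \<Longrightarrow> \<exists>c>0. \<forall>\<^sub>F t in sequentially. c \<le> norm (orth_proj (S d A) (w_decay l A t))"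
      "\<exists>C>0. \<forall>t b. general_cond l d A t \<and> ball_minimizer l d A (w_decay l A t) b \<longrightarrow>
        max ((norm (orth_proj (S d A) (w_decay l A t) - vbar l d A))\<^sup>2)
            ((norm (orth_proj (S d A) b - vbar l d A))\<^sup>2)
          \<le> C * (ln (real t) ^ 2 / sqrt (real t))"
      "Ac d A \<noteq> [] \<Longrightarrow> \<exists>c>0. \<exists>C>0. \<forall>t. general_cond l d A t \<longrightarrow>
        c * ln (real t) \<le> norm (orth_proj (Sperp d A) (w_decay l A t)) \<and>
        norm (orth_proj (Sperp d A) (w_decay l A t)) \<le> C * ln (real t)"
      by blast+
  qed
qed

end
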